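(* Let $X_1,\dots,X_d$ be $\sigma$-finite measure spaces and suppose $f\in L^2(X_1\times\dots\times X_d)$ has a decomposition $$f=\sum_{p=1}^r\lambda_p\,\varphi_{1p}\otimes\dots\otimes\varphi_{dp}$$ with nonzero coefficients $\lambda_p\in\mathbb{C}$, where for each $k$ the set $\Phi_k=\{\varphi_{k1},\dots,\varphi_{kr}\}\subseteq L^2(X_k)$ consists of unit-norm elements and $\operatorname{krank}\Phi_k<\dim\operatorname{span}\Phi_k$. Let $\mu_k=\mu(\Phi_k)$ and $\omega_k=\omega(\Phi_k)=(1-\mu_k)/\mu_k$. If $$\sum_{k=1}^d\omega_k\ge 2r-1,$$ equivalently $\sum_{k=1}^d 1/\mu_k\ge 2r+d-1$, then $r=\operatorname{rank}(f)$ and the decomposition is essentially unique.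
   Context: $\varphi_1\otimes\dots\otimes\varphi_d$ denotes $(\mathbf{x}_1,\dots,\mathbf{x}_d)\mapsto\prod_k\varphi_k(\mathbf{x}_k)$. $\operatorname{rank}(f)$ is the minimal number of such tensor products summing to $f$. Kruskal rank $\operatorname{krank}\Phi$: the largest $k$ such that every $k$-element subset of $\Phi$ is linearly independent. Coherence: $\mu(\Phi)=\max_{\varphi\ne\psi\in\Phi}\lvert\langle\varphi,\psi\rangle\rvert$. Essentially unique: for any other decomposition $f=\sum_{p=1}^r\lambda'_p\psi_{1p}\otimes\dots\otimes\psi_{dp}$ with unit-norm factors, after a relabelling of the terms one has $\lambda'_p\psi_{1p}\otimes\dots\otimes\psi_{dp}=\lambda_p\varphi_{1p}\otimes\dots\otimes\varphi_{dp}$ for every $p$, i.e. the factors agree up to unimodular scalars (whose product compensates the coefficients) and the terms agree up to permutation; in normalized form (coefficients real with $\lambda_1\ge\dots\ge\lambda_r>0$) this means equal coefficients and factors equal up to unimodular scalars whose phases sum to $0 \bmod 2\pi$, with relabelling only within blocks of equal coefficients. *)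

theory Defs
  imports "HOL-Analysis.Analysis"
begin

text \<open>Elements of L^2(M) are represented by complex-valued representatives;
  all identities are understood almost everywhere.\<close>

definition memL2 :: "'a measure \<Rightarrow> ('a \<Rightarrow> complex) \<Rightarrow> bool" where
  "memL2 M g \<longleftrightarrow> g \<in> borel_measurable M \<and> integrable M (\<lambda>x. (cmod (g x))\<^sup>2)"

definition L2_inner :: "'a measure \<Rightarrow> ('a \<Rightarrow> complex) \<Rightarrow> ('a \<Rightarrow> complex) \<Rightarrow> complex" where
  "L2_inner M g h = (\<integral>x. g x * cnj (h x) \<partial>M)"

definition L2_norm :: "'a measure \<Rightarrow> ('a \<Rightarrow> complex) \<Rightarrow> real" where
  "L2_norm M g = sqrt (\<integral>x. (cmod (g x))\<^sup>2 \<partial>M)"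

definition lin_indep_L2 :: "'a measure \<Rightarrow> (nat \<Rightarrow> 'a \<Rightarrow> complex) \<Rightarrow> nat set \<Rightarrow> bool" where
  "lin_indep_L2 M g S \<longleftrightarrow>
     (\<forall>c :: nat \<Rightarrow> complex. (AE x in M. (\<Sum>p\<in>S. c p * g p x) = 0) \<longrightarrow> (\<forall>p\<in>S. c p = 0))"

definition krank :: "'a measure \<Rightarrow> (nat \<Rightarrow> 'a \<Rightarrow> complex) \<Rightarrow> nat \<Rightarrow> nat" where
  "krank M g r = (GREATEST k. k \<le> r \<and> (\<forall>S \<subseteq> {..<r}. card S = k \<longrightarrow> lin_indep_L2 M g S))"

definition dim_span :: "'a measure \<Rightarrow> (nat \<Rightarrow> 'a \<Rightarrow> complex) \<Rightarrow> nat \<Rightarrow> nat" where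
  "dim_span M g r = (GREATEST k. \<exists>S \<subseteq> {..<r}. card S = k \<and> lin_indep_L2 M g S)"

definition coherence :: "'a measure \<Rightarrow> (nat \<Rightarrow> 'a \<Rightarrow> complex) \<Rightarrow> nat \<Rightarrow> real" where
  "coherence M g r = Max {cmod (L2_inner M (g p) (g q)) | p q. p < r \<and> q < r \<and> p \<noteq> q}"

definition omega :: "'a measure \<Rightarrow> (nat \<Rightarrow> 'a \<Rightarrow> complex) \<Rightarrow> nat \<Rightarrow> real" where
  "omega M g r = (1 - coherence M g r) / coherence M g r"

definition tensor :: "nat \<Rightarrow> (nat \<Rightarrow> 'a \<Rightarrow> complex) \<Rightarrow> (nat \<Rightarrow> 'a) \<Rightarrow> complex" where
  "tensor d \<psi> x = (\<Prod>k<d. \<psi> k (x k))"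

definition prodM :: "nat \<Rightarrow> (nat \<Rightarrow> 'a measure) \<Rightarrow> (nat \<Rightarrow> 'a) measure" where
  "prodM d M = (\<Pi>\<^sub>M k\<in>{..<d}. M k)"

definition is_decomp :: "nat \<Rightarrow> (nat \<Rightarrow> 'a measure) \<Rightarrow> ((nat \<Rightarrow> 'a) \<Rightarrow> complex) \<Rightarrow> nat
    \<Rightarrow> (nat \<Rightarrow> complex) \<Rightarrow> (nat \<Rightarrow> nat \<Rightarrow> 'a \<Rightarrow> complex) \<Rightarrow> bool" where
  "is_decomp d M f s c \<psi> \<longleftrightarrow>
     (\<forall>k<d. \<forall>p<s. memL2 (M k) (\<psi> k p)) \<and>
     (AE x in prodM d M. f x = (\<Sum>p<s. c p * tensor d (\<lambda>k. \<psi> k p) x))"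

definition tensor_rank :: "nat \<Rightarrow> (nat \<Rightarrow> 'a measure) \<Rightarrow> ((nat \<Rightarrow> 'a) \<Rightarrow> complex) \<Rightarrow> nat" where
  "tensor_rank d M f = (LEAST s. \<exists>c \<psi>. is_decomp d M f s c \<psi>)"

end

theory Submission
  imports Defs "HOL-Library.Function_Algebras"
begin

text \<open>
  Comparing a dependent family with its Gram matrix (unit diagonal, off-diagonal entries at most
  $\mu_k$) gives $\mathrm{krank}\,\Phi_k \ge 1/\mu_k = \omega_k + 1$, so the hypothesis on the
  $\omega_k$ implies Kruskal's condition $\sum_k (\mathrm{krank}\,\Phi_k - 1) \ge 2r - 1$. It remains to prove
  the $d$-factor Kruskal theorem, along the lines of Lovitz and Petrov. A family $E$ of nonzero
  product vectors that does not split into two parts with independent spans satisfies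
  $\dim\,\mathrm{span}\,E \ge 1 + \sum_k (d_k - 1)$, where $d_k$ is the dimension of the span of the
  $k$-th factors. The union of the terms of two decompositions of $f$ satisfies a linear relation and violates
  this inequality, hence splits; each part is again balanced, and induction pairs off equal terms.

  The $L^2$ functions are replaced by their inner products with the finitely many functions
  occurring in the two decompositions. On the span of these functions nothing is lost modulo null functions, and
  almost-everywhere identities between tensors become pointwise identities by Fubini's theorem.
\<close>

subsection \<open>Families of functions: span, rank, independence\<close>

text \<open>Addition of functions comes from the pointwise group instance; supplying the scaling
  makes the library notions of span, basis and dimension available for functions on any index
  type.\<close>

interpretation fs: vector_space "\<lambda>(c::complex) (h::'i \<Rightarrow> complex) i. c * h i"
  by unfold_locales (auto simp: fun_eq_iff algebra_simps)

text \<open>Coefficients belong to indices, not to vectors, so equal members of a family stay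
  separate summands. This matters because terms of two decompositions may coincide.\<close>

definition lcomb :: "('e \<Rightarrow> 'i \<Rightarrow> complex) \<Rightarrow> 'e set \<Rightarrow> ('e \<Rightarrow> complex) \<Rightarrow> 'i \<Rightarrow> complex" where
  "lcomb g A c = (\<lambda>i. \<Sum>a\<in>A. c a * g a i)"

definition fspan :: "('e \<Rightarrow> 'i \<Rightarrow> complex) \<Rightarrow> 'e set \<Rightarrow> ('i \<Rightarrow> complex) set" where
  "fspan g A = range (lcomb g A)"

definition frank :: "('e \<Rightarrow> 'i \<Rightarrow> complex) \<Rightarrow> 'e set \<Rightarrow> nat" where
  "frank g A = fs.dim (g ` A)"

text \<open>Linear independence of the family over \<open>N\<close> in the quotient by the span over
  \<open>P\<close>.\<close>

definition indep_mod :: "('e \<Rightarrow> 'i \<Rightarrow> complex) \<Rightarrow> 'e set \<Rightarrow> 'e set \<Rightarrow> bool" where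
  "indep_mod g P N \<longleftrightarrow> (\<forall>c. lcomb g N c \<in> fspan g P \<longrightarrow> (\<forall>a\<in>N. c a = 0))"

lemma sum_fun_apply: "(\<Sum>a\<in>A. F a) i = (\<Sum>a\<in>A. F a i :: complex)"
  by (induction A rule: infinite_finite_induct) auto

lemma lcomb_eq_sum: "lcomb g A c = (\<Sum>a\<in>A. (\<lambda>i. c a * g a i))"
  by (auto simp: lcomb_def sum_fun_apply)

lemma lcomb_in_span: "lcomb g A c \<in> fs.span (g ` A)"
  unfolding lcomb_eq_sum by (intro fs.span_sum fs.span_scale fs.span_base) auto

lemma lcomb_in_fspan [simp]: "lcomb g A c \<in> fspan g A"
  by (auto simp: fspan_def)

lemma subspace_fspan: "fs.subspace (fspan g A)"
  unfolding fs.subspace_def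
proof (intro conjI ballI allI)
  show "0 \<in> fspan g A"
    using lcomb_in_fspan[of g A "\<lambda>_. 0"] by (simp add: lcomb_def zero_fun_def)
next
  fix h k assume "h \<in> fspan g A" "k \<in> fspan g A"
  then obtain c d where "h = lcomb g A c" "k = lcomb g A d" by (auto simp: fspan_def)
  then have "h + k = lcomb g A (\<lambda>a. c a + d a)"
    by (auto simp: lcomb_def fun_eq_iff algebra_simps sum.distrib)
  then show "h + k \<in> fspan g A" by simp
next
  fix b h assume "h \<in> fspan g A"
  then obtain c where "h = lcomb g A c" by (auto simp: fspan_def)
  then have "(\<lambda>i. b * h i) = lcomb g A (\<lambda>a. b * c a)"
    by (auto simp: lcomb_def fun_eq_iff algebra_simps sum_distrib_left)
  then show "(\<lambda>i. b * h i) \<in> fspan g A" by simp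
qed

lemma in_fspan: 
  assumes "finite A" "a \<in> A" shows "g a \<in> fspan g A"
proof -
  have "g a = lcomb g A (\<lambda>b. if b = a then 1 else 0)"
    using assms by (auto simp: lcomb_def fun_eq_iff if_distrib[of "\<lambda>x. x * _"] cong: if_cong)
  then show ?thesis by (metis lcomb_in_fspan)
qed

lemma span_image_eq_fspan:
  assumes "finite A" shows "fs.span (g ` A) = fspan g A"
proof
  show "fs.span (g ` A) \<subseteq> fspan g A"
    by (rule fs.span_minimal[OF _ subspace_fspan]) (auto intro: in_fspan assms)
  show "fspan g A \<subseteq> fs.span (g ` A)"
    by (auto simp: fspan_def lcomb_in_span)
qed

lemma fspan_mono:
  assumes "finite B" "A \<subseteq> B" shows "fspan g A \<subseteq> fspan g B"
  using assms by (metis fs.span_mono image_mono finite_subset span_image_eq_fspan)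

lemma zero_in_fspan [simp]: "(\<lambda>_. 0) \<in> fspan g A"
  using fs.subspace_0[OF subspace_fspan, of g A] by (simp add: zero_fun_def)

lemma fspan_diff: "h \<in> fspan g A \<Longrightarrow> k \<in> fspan g A \<Longrightarrow> (\<lambda>i. h i - k i) \<in> fspan g A"
  using fs.subspace_diff[OF subspace_fspan, of h g A k] by (simp add: fun_diff_def)

lemma fspan_scale: "h \<in> fspan g A \<Longrightarrow> (\<lambda>i. c * h i) \<in> fspan g A"
  using fs.subspace_scale[OF subspace_fspan, of h g A c] by simp

lemma fspan_sum: 
  assumes "\<And>b. b \<in> B \<Longrightarrow> h b \<in> fspan g A" shows "(\<lambda>i. \<Sum>b\<in>B. h b i) \<in> fspan g A"
proof -
  have "(\<lambda>i. \<Sum>b\<in>B. h b i) = sum h B" by (simp add: fun_eq_iff sum_fun_apply)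
  then show ?thesis using fs.subspace_sum[OF subspace_fspan, of B h g A] assms by simp
qed

lemma lcomb_cong: "A = B \<Longrightarrow> (\<And>a. a \<in> B \<Longrightarrow> c a = d a) \<Longrightarrow> lcomb g A c = lcomb g B d"
  by (auto simp: lcomb_def)

lemma lcomb_mono_neutral:
  assumes "finite B" "A \<subseteq> B" "\<And>a. a \<in> B - A \<Longrightarrow> c a = 0"
  shows "lcomb g B c = lcomb g A c"
  unfolding lcomb_def by (intro ext sum.mono_neutral_right) (use assms in auto)

lemma fspan_Un_cases:
  assumes "finite A" "finite B" "h \<in> fspan g (A \<union> B)"
  obtains k c where "k \<in> fspan g A" "\<And>i. h i = k i + lcomb g B c i"
proof -
  obtain e where e: "h = lcomb g (A \<union> B) e" using assms(3) by (auto simp: fspan_def)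
  \<comment> \<open>Indices lying in both sets are charged to \<open>A\<close>, hence the
    coefficient 0 there.\<close>
  have "h i = lcomb g A e i + lcomb g B (\<lambda>a. if a \<in> A then 0 else e a) i" for i
  proof -
    have "lcomb g (A \<union> B) e i = lcomb g A e i + lcomb g (B - A) e i"
      unfolding lcomb_def using assms by (subst sum.union_disjoint[symmetric]) auto
    also have "lcomb g (B - A) e = lcomb g (B - A) (\<lambda>a. if a \<in> A then 0 else e a)"
      by (rule lcomb_cong) auto
    also have "\<dots> = lcomb g B (\<lambda>a. if a \<in> A then 0 else e a)"
      by (rule lcomb_mono_neutral[symmetric]) (use assms in auto)
    finally show ?thesis by (simp add: e)
  qed
  then show ?thesis by (intro that[of "lcomb g A e"]) auto
qed

text \<open>A basis of the span over \<open>P\<close>, chosen among its members, is extended to one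
  for \<open>P \<union> N\<close>. Every added vector comes from \<open>N\<close>, and
  \<open>N1\<close> keeps one index for each, so that rank growth is counted by indices.\<close>

lemma frank_basis_mod:
  assumes "finite P" "finite N"
  obtains N1 where "N1 \<subseteq> N" "frank g (P \<union> N) = frank g P + card N1"
    "\<And>a. a \<in> P \<union> N \<Longrightarrow> g a \<in> fspan g (P \<union> N1)"
    "indep_mod g P N1"
proof -
  obtain B0 where B0: "B0 \<subseteq> g ` P" "fs.independent B0" "g ` P \<subseteq> fs.span B0" "card B0 = frank g P"
    unfolding frank_def by (rule fs.basis_exists)
  have spB0: "fs.span B0 = fspan g P"
    using B0 assms by (metis fs.span_minimal fs.span_mono fs.subspace_span span_image_eq_fspan subset_antisym)
  obtain B where B: "B0 \<subseteq> B" "B \<subseteq> g ` (P \<union> N)" "fs.independent B" "g ` (P \<union> N) \<subseteq> fs.span B"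
    by (rule fs.maximal_independent_subset_extend[of B0 "g ` (P \<union> N)"]) (use B0 in auto)
  have finB: "finite B" using B(2) assms finite_subset by blast
  have "B - B0 \<subseteq> g ` N"
  proof
    fix b assume b: "b \<in> B - B0"
    have "b \<notin> g ` P"
    proof
      assume "b \<in> g ` P"
      then have "b \<in> fs.span (B - {b})" using B0(3) b B(1) fs.span_mono[of B0 "B - {b}"] by auto
      then show False using B(3) b by (auto simp: fs.dependent_def)
    qed
    then show "b \<in> g ` N" using b B(2) by auto
  qed
  then obtain N1 where N1: "N1 \<subseteq> N" "inj_on g N1" "B - B0 = g ` N1"
    by (metis subset_image_inj)
  have card: "card B = card B0 + card N1"
    using B(1) finB N1 by (metis card_Un_disjoint Diff_disjoint Diff_partition card_image finite_Diff finite_subset)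
  have fN1: "finite N1" using N1 assms finite_subset by blast
  have dimB: "frank g (P \<union> N) = card B"
    unfolding frank_def using B by (intro fs.dim_unique) auto
  have "B \<subseteq> g ` (P \<union> N1)" using N1(3) B0(1) by blast
  then have sp: "g ` (P \<union> N) \<subseteq> fspan g (P \<union> N1)"
    using B(4) fs.span_mono span_image_eq_fspan[of "P \<union> N1" g] assms(1) fN1 by blast
  show ?thesis
  proof
    show "N1 \<subseteq> N" by fact
    show "frank g (P \<union> N) = frank g P + card N1" using dimB card B0(4) by simp
    show "g a \<in> fspan g (P \<union> N1)" if "a \<in> P \<union> N" for a using sp that by blast
  next
    have "c a = 0" if c: "lcomb g N1 c \<in> fspan g P" and a: "a \<in> N1" for c a
    proof -
      \<comment> \<open>\<open>c'\<close> moves the coefficients from indices to vectors;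
        \<open>g\<close> is injective on \<open>N1\<close>.\<close>
      define c' where "c' = c \<circ> inv_into N1 g"
      have "lcomb g N1 c = (\<Sum>b\<in>B - B0. (\<lambda>i. c' b * b i))"
        unfolding N1(3) lcomb_eq_sum sum.reindex[OF N1(2)] using N1(2) by (auto simp: c'_def intro!: sum.cong)
      moreover obtain d where "lcomb g N1 c = (\<Sum>b\<in>B0. (\<lambda>i. d b * b i))"
        using c B(1) finB finite_subset unfolding spB0[symmetric] by (subst (asm) fs.span_finite) auto
      ultimately have eq: "(\<Sum>b\<in>B - B0. (\<lambda>i. c' b * b i)) = (\<Sum>b\<in>B0. (\<lambda>i. d b * b i))" by simp
      \<comment> \<open>\<open>e\<close> joins both expansions into one vanishing combination of the
        basis \<open>B\<close>.\<close>
      define e where "e b = (if b \<in> B0 then - d b else c' b)" for b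
      have "(\<Sum>b\<in>B. (\<lambda>i. e b * b i)) = (\<Sum>b\<in>B - B0. (\<lambda>i. e b * b i)) + (\<Sum>b\<in>B0. (\<lambda>i. e b * b i))"
        using sum.subset_diff[OF B(1) finB] .
      also have "(\<Sum>b\<in>B0. (\<lambda>i. e b * b i)) = - (\<Sum>b\<in>B0. (\<lambda>i. d b * b i))"
        by (auto simp: e_def sum_fun_apply fun_eq_iff sum_negf)
      also have "(\<Sum>b\<in>B - B0. (\<lambda>i. e b * b i)) = (\<Sum>b\<in>B - B0. (\<lambda>i. c' b * b i))"
        by (intro sum.cong) (auto simp: e_def)
      finally have "(\<Sum>b\<in>B. (\<lambda>i. e b * b i)) = 0" using eq by (simp add: zero_fun_def)
      then have "e (g a) = 0"
        using B(3) finB a N1 B(1) by (intro fs.independentD[of B B e "g a"]) auto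
      then show "c a = 0" using a N1 by (auto simp: e_def c'_def split: if_splits)
    qed
    then show "indep_mod g P N1" by (auto simp: indep_mod_def)
  qed
qed

lemma frank_empty [simp]: "frank g {} = 0"
  unfolding frank_def by (rule fs.dim_unique[of "{}"]) (auto simp: fs.dependent_explicit)

lemma frank_mono:
  assumes "finite B" "A \<subseteq> B" shows "frank g A \<le> frank g B"
proof -
  obtain N1 where "N1 \<subseteq> B" "frank g (A \<union> B) = frank g A + card N1"
    by (rule frank_basis_mod[of A B g]) (use assms finite_subset in auto)
  then show ?thesis using assms(2) by (simp add: Un_absorb1)
qed

lemma frank_le_card:
  assumes "finite A" shows "frank g A \<le> card A"
proof -
  obtain N1 where "N1 \<subseteq> A" "frank g ({} \<union> A) = frank g {} + card N1"
    by (rule frank_basis_mod[of "{}" A g]) (use assms in auto)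
  then show ?thesis using assms by (simp add: card_mono)
qed

lemma fspan_empty [simp]: "fspan g {} = {\<lambda>_. 0}"
  by (auto simp: fspan_def lcomb_def)

lemma frank_eq_card:
  assumes "finite A" "\<And>c a. lcomb g A c = (\<lambda>_. 0) \<Longrightarrow> a \<in> A \<Longrightarrow> c a = 0"
  shows "frank g A = card A"
proof -
  obtain N1 where N1: "N1 \<subseteq> A" "frank g ({} \<union> A) = frank g {} + card N1"
    "\<And>a. a \<in> {} \<union> A \<Longrightarrow> g a \<in> fspan g ({} \<union> N1)"
    by (rule frank_basis_mod[of "{}" A g]) (use assms in auto)
  have "N1 = A"
  proof (rule ccontr)
    assume "N1 \<noteq> A"
    then obtain a where a: "a \<in> A" "a \<notin> N1" using N1 by blast
    then obtain e where e: "g a = lcomb g N1 e" using N1(3)[of a] by (auto simp: fspan_def)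
    \<comment> \<open>Moving the expansion of \<open>g a\<close> to the other side gives a relation
      with coefficient 1 at \<open>a\<close>, which the assumption forbids.\<close>
    define c where "c b = (if b = a then 1 else if b \<in> N1 then - e b else 0)" for b
    have fN: "finite N1" using N1 assms finite_subset by blast
    have "lcomb g A c = lcomb g (insert a N1) c"
      by (rule lcomb_mono_neutral) (use assms N1 a in \<open>auto simp: c_def\<close>)
    also have "\<dots> = (\<lambda>i. g a i - lcomb g N1 e i)"
      using fN a by (auto simp: lcomb_def c_def fun_eq_iff simp flip: sum_negf intro!: sum.cong)
    also have "\<dots> = (\<lambda>_. 0)" by (simp add: e[symmetric])
    finally show False using assms(2)[of c a] a by (simp add: c_def)
  qed
  then show ?thesis using N1 by simp
qed

lemma frank_less_card:
  assumes "finite A" "lcomb g A c = (\<lambda>_. 0)" "a \<in> A" "c a \<noteq> 0"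
  shows "frank g A < card A"
proof -
  obtain N1 where N1: "N1 \<subseteq> A" "frank g ({} \<union> A) = frank g {} + card N1"
    "indep_mod g {} N1"
    by (rule frank_basis_mod[of "{}" A g]) (use assms in auto)
  have "N1 \<noteq> A" using N1(3) assms by (auto simp: indep_mod_def)
  then show ?thesis using N1 assms(1) by (simp add: psubset_card_mono psubsetI)
qed

text \<open>Modulo the span over \<open>P\<close>, the members of \<open>N2\<close> span everything
  coming from \<open>N\<close>; a spanning family as large as the dimension is independent.\<close>

lemma frank_Un_le:
  assumes "finite P" "finite N" "N2 \<subseteq> N" and sp: "\<And>a. a \<in> N \<Longrightarrow> g a \<in> fspan g (P \<union> N2)"
  shows "frank g (P \<union> N) \<le> frank g P + card N2"
    and "frank g (P \<union> N) = frank g P + card N2 \<Longrightarrow> indep_mod g P N2"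
proof -
  have fN2: "finite N2" using assms finite_subset by blast
  have *: "fs.span (g ` (P \<union> N)) = fs.span (g ` (P \<union> N2))"
  proof
    show "fs.span (g ` (P \<union> N)) \<subseteq> fs.span (g ` (P \<union> N2))"
      by (rule fs.span_minimal) (use sp in_fspan[of "P \<union> N2"] assms(1) fN2 in \<open>auto simp: span_image_eq_fspan subspace_fspan\<close>)
    show "fs.span (g ` (P \<union> N2)) \<subseteq> fs.span (g ` (P \<union> N))"
      by (rule fs.span_mono) (use assms in auto)
  qed
  have eq: "frank g (P \<union> N) = frank g (P \<union> N2)"
    unfolding frank_def by (rule fs.span_eq_dim[OF *])
  obtain N1 where N1: "N1 \<subseteq> N2" "frank g (P \<union> N2) = frank g P + card N1"
    "indep_mod g P N1"
    by (rule frank_basis_mod[of P N2 g]) (use assms fN2 in auto)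
  show "frank g (P \<union> N) \<le> frank g P + card N2"
    using eq N1 fN2 by (simp add: card_mono)
  show "indep_mod g P N2" if "frank g (P \<union> N) = frank g P + card N2"
  proof -
    have "card N1 = card N2" using that eq N1(2) by simp
    then have "N1 = N2" using N1(1) fN2 by (simp add: card_subset_eq)
    then show ?thesis using N1(3) that by simp
  qed
qed

subsection \<open>Connected families of product vectors\<close>

text \<open>Says that \<open>x a\<close> is the tensor product of \<open>u a\<close> and
  \<open>v a\<close>, with one correspondence of coordinates serving all \<open>a\<close>. The
  relational form is symmetric in the factors and covers functions of tuples as well as of
  pairs.\<close>

definition is_product :: "('e \<Rightarrow> 'z \<Rightarrow> complex) \<Rightarrow> ('e \<Rightarrow> 'i \<Rightarrow> complex) \<Rightarrow> ('e \<Rightarrow> 'j \<Rightarrow> complex) \<Rightarrow> bool" where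
  "is_product x u v \<longleftrightarrow> (\<forall>i j. \<exists>z. \<forall>a. x a z = u a i * v a j) \<and> (\<forall>z. \<exists>i j. \<forall>a. x a z = u a i * v a j)"

lemma is_product_swap: "is_product x u v \<Longrightarrow> is_product x v u"
  unfolding is_product_def by (metis mult.commute)

text \<open>Fixing the second coordinate at \<open>j\<close> turns a relation between tensors into
  one between first factors, where \<open>v a j\<close> is absorbed into the coefficients.\<close>

lemma is_product_slice:
  assumes "is_product x u v" "lcomb x N c \<in> fspan x P"
  shows "lcomb u N (\<lambda>a. c a * v a j) \<in> fspan u P"
proof -
  obtain e where e: "lcomb x N c = lcomb x P e" using assms(2) by (auto simp: fspan_def)
  have "lcomb u N (\<lambda>a. c a * v a j) = lcomb u P (\<lambda>a. e a * v a j)"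
  proof
    fix i
    obtain z where z: "\<And>a. x a z = u a i * v a j"
      using assms(1) unfolding is_product_def by blast
    have "lcomb x N c z = lcomb x P e z" using e by simp
    then show "lcomb u N (\<lambda>a. c a * v a j) i = lcomb u P (\<lambda>a. e a * v a j) i"
      by (simp add: lcomb_def z mult_ac)
  qed
  then show ?thesis by simp
qed

text \<open>Members outside \<open>N1\<close> are eliminated by their expansions; what remains of
  them are the parts \<open>h a\<close>, later taken in the span over \<open>P\<close> or equal to
  zero.\<close>

lemma lcomb_substitute:
  assumes "finite N" "N1 \<subseteq> N"
    and "\<And>a i. a \<in> N - N1 \<Longrightarrow> u a i = h a i + lcomb u N1 (\<gamma> a) i"
  shows "lcomb u N1 (\<lambda>b. e b + (\<Sum>a\<in>N-N1. e a * \<gamma> a b)) i = lcomb u N e i - (\<Sum>a\<in>N-N1. e a * h a i)"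
proof -
  have "lcomb u N e i = (\<Sum>a\<in>N-N1. e a * u a i) + lcomb u N1 e i"
    unfolding lcomb_def using assms by (intro sum.subset_diff) auto
  also have "(\<Sum>a\<in>N-N1. e a * u a i) = (\<Sum>a\<in>N-N1. e a * h a i) + (\<Sum>a\<in>N-N1. \<Sum>b\<in>N1. e a * \<gamma> a b * u b i)"
    by (simp add: assms(3) distrib_left sum.distrib lcomb_def sum_distrib_left mult.assoc)
  also have "(\<Sum>a\<in>N-N1. \<Sum>b\<in>N1. e a * \<gamma> a b * u b i) = (\<Sum>b\<in>N1. (\<Sum>a\<in>N-N1. e a * \<gamma> a b) * u b i)"
    by (subst sum.swap) (simp add: sum_distrib_right)
  finally show ?thesis by (simp add: lcomb_def distrib_right sum.distrib)
qed

text \<open>Modulo the span of $u_P$ the relation becomes $\sum_{b \in N_1} u_b \otimes w_b = 0$ with the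
  $u_b$ independent, so every $w_b$ vanishes.\<close>

lemma ear_coefficients:
  assumes prod: "is_product x u v" and fin: "finite N" "N1 \<subseteq> N"
    and mem: "lcomb x N c \<in> fspan x P"
    and indep: "indep_mod u P N1"
    and h: "\<And>a. a \<in> N - N1 \<Longrightarrow> h a \<in> fspan u P"
    and u: "\<And>a i. a \<in> N - N1 \<Longrightarrow> u a i = h a i + lcomb u N1 (\<gamma> a) i"
    and b: "b \<in> N1"
  shows "c b * v b j + (\<Sum>a\<in>N-N1. c a * v a j * \<gamma> a b) = 0"
proof -
  define e where "e a = c a * v a j" for a
  have "lcomb u N1 (\<lambda>b. e b + (\<Sum>a\<in>N-N1. e a * \<gamma> a b)) = (\<lambda>i. lcomb u N e i - (\<Sum>a\<in>N-N1. e a * h a i))"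
    using lcomb_substitute[where e = e, OF fin u] by blast
  also have "\<dots> \<in> fspan u P"
    using is_product_slice[OF prod mem, of j] h
    by (intro fspan_diff fspan_sum fspan_scale) (auto simp: e_def[abs_def])
  finally show ?thesis using indep b by (auto simp: e_def indep_mod_def)
qed

text \<open>Since \<open>c b\<close> is nonzero, the coefficient identity can be solved for
  \<open>v b\<close>. So the indices that account for the rank growth of \<open>u\<close> add
  nothing to \<open>v\<close> beyond \<open>N - N1\<close>, and the two growths together are at most
  \<open>card N\<close>.\<close>

lemma ear_span:
  assumes prod: "is_product x u v" and fin: "finite P" "finite N" "N1 \<subseteq> N"
    and mem: "lcomb x N c \<in> fspan x P" and c: "\<And>a. a \<in> N \<Longrightarrow> c a \<noteq> 0"
    and indep: "indep_mod u P N1"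
    and span: "\<And>a. a \<in> N \<Longrightarrow> u a \<in> fspan u (P \<union> N1)"
    and b: "b \<in> N1"
  shows "v b \<in> fspan v (N - N1)"
proof -
  have fN1: "finite N1" using fin finite_subset by blast
  have "\<exists>h \<gamma>. h \<in> fspan u P \<and> (\<forall>i. u a i = h i + lcomb u N1 \<gamma> i)" if "a \<in> N - N1" for a
    using fspan_Un_cases[OF fin(1) fN1 span[of a]] that by blast
  then obtain h \<gamma> where h: "\<And>a. a \<in> N - N1 \<Longrightarrow> h a \<in> fspan u P"
     "\<And>a i. a \<in> N - N1 \<Longrightarrow> u a i = h a i + lcomb u N1 (\<gamma> a) i"
    by metis
  have "v b = lcomb v (N - N1) (\<lambda>a. - (c a * \<gamma> a b) / c b)"
  proof
    fix j
    have "c b * v b j + (\<Sum>a\<in>N-N1. c a * v a j * \<gamma> a b) = 0"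
      using ear_coefficients[where u = u and h = h and \<gamma> = \<gamma> and c = c, OF prod fin(2,3) mem indep h b] by blast
    moreover have "c b \<noteq> 0" using c b fin by blast
    ultimately have "v b j = - (\<Sum>a\<in>N-N1. c a * v a j * \<gamma> a b) / c b"
      by (simp add: field_simps add_eq_0_iff2)
    then show "v b j = lcomb v (N - N1) (\<lambda>a. - (c a * \<gamma> a b) / c b) j"
      by (simp add: lcomb_def sum_divide_distrib sum_negf mult_ac)
  qed
  then show ?thesis by (metis lcomb_in_fspan)
qed

text \<open>The bound with $\le$ follows from \<open>ear_span\<close>. In case of equality the argument applies with $u$ and
  $v$ exchanged, so the $u_a$ lie in the span of $u_{N_1}$ itself, and the coefficient
  comparison forces the relation on $N$ to be trivial.\<close>

lemma ear_step:
  assumes prod: "is_product x u v" and fin: "finite P" "finite N"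
    and mem: "lcomb x N c \<in> fspan x P" and nz: "lcomb x N c \<noteq> (\<lambda>_. 0)"
    and c: "\<And>a. a \<in> N \<Longrightarrow> c a \<noteq> 0"
  shows "frank u (P \<union> N) + frank v (P \<union> N) < frank u P + frank v P + card N"
proof (rule ccontr)
  assume contra: "\<not> ?thesis"
  obtain N1 where N1: "N1 \<subseteq> N" "frank u (P \<union> N) = frank u P + card N1"
    "\<And>a. a \<in> P \<union> N \<Longrightarrow> u a \<in> fspan u (P \<union> N1)"
    "indep_mod u P N1"
    by (rule frank_basis_mod[of P N u]) (use fin in auto)
  have fN1: "finite N1" using fin N1 finite_subset by blast
  have uN: "u a \<in> fspan u (P \<union> N1)" if "a \<in> N" for a using N1(3) that by blast
  have vN1: "v b \<in> fspan v (N - N1)" if "b \<in> N1" for b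
    using ear_span[where u = u and c = c and P = P, OF prod fin N1(1) mem c N1(4) uN that] by blast
  have sp: "v a \<in> fspan v (P \<union> (N - N1))" if "a \<in> N" for a
  proof (cases "a \<in> N1")
    case True
    then show ?thesis using vN1 fspan_mono[of "P \<union> (N - N1)" "N - N1" v] fin by blast
  next
    case False
    then show ?thesis using that fin by (intro in_fspan) auto
  qed
  have card: "card N1 + card (N - N1) = card N"
    using N1(1) fin fN1 by (simp add: card_Diff_subset card_mono)
  have "frank v (P \<union> N) \<le> frank v P + card (N - N1)"
    by (rule frank_Un_le(1)[OF fin _ sp]) auto
  then have eq: "frank v (P \<union> N) = frank v P + card (N - N1)"
    using contra N1(2) card by linarith
  have indep: "indep_mod v P (N - N1)"
    by (rule frank_Un_le(2)[OF fin _ sp eq]) auto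
  have "u a \<in> fspan u N1" if "a \<in> N - N1" for a
  proof -
    have "u a \<in> fspan u (N - (N - N1))"
      using ear_span[where u = v and c = c and P = P, OF is_product_swap[OF prod] fin Diff_subset mem c indep sp that] by blast
    then show ?thesis using N1(1) by (simp add: double_diff)
  qed
  then have "\<exists>\<gamma>. u a = lcomb u N1 \<gamma>" if "a \<in> N - N1" for a
    using that by (auto simp: fspan_def)
  then obtain \<gamma> where \<gamma>: "\<And>a. a \<in> N - N1 \<Longrightarrow> u a = lcomb u N1 (\<gamma> a)"
    by metis
  have "lcomb x N c = (\<lambda>_. 0)"
  proof
    fix z
    obtain i j where ij: "\<And>a. x a z = u a i * v a j"
      using prod unfolding is_product_def by blast
    define e where "e a = c a * v a j" for a
    \<comment> \<open>Here the remainders are zero, so the slice vanishes exactly and not only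
      modulo the span over \<open>P\<close>.\<close>
    have "e b + (\<Sum>a\<in>N-N1. e a * \<gamma> a b) = 0" if "b \<in> N1" for b
      unfolding e_def
      by (rule ear_coefficients[where u = u and P = P and h = "\<lambda>_ _. 0", OF prod fin(2) N1(1) mem N1(4)])
        (use \<gamma> that in auto)
    then have "lcomb u N1 (\<lambda>b. e b + (\<Sum>a\<in>N-N1. e a * \<gamma> a b)) i = 0"
      by (simp add: lcomb_def)
    also have "lcomb u N1 (\<lambda>b. e b + (\<Sum>a\<in>N-N1. e a * \<gamma> a b)) i = lcomb u N e i"
      using lcomb_substitute[OF fin(2) N1(1), of u "\<lambda>_ _. 0" \<gamma> e i] \<gamma> by simp
    finally show "lcomb x N c z = 0" by (simp add: lcomb_def ij e_def mult_ac)
  qed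
  then show False using nz by simp
qed

text \<open>A separation of the linear matroid on \<open>E\<close>; its absence is
  connectedness.\<close>

definition splits :: "('e \<Rightarrow> 'i \<Rightarrow> complex) \<Rightarrow> 'e set \<Rightarrow> bool" where
  "splits x E \<longleftrightarrow> (\<exists>P\<subseteq>E. P \<noteq> {} \<and> P \<noteq> E \<and> (\<forall>h. h \<in> fspan x P \<longrightarrow> h \<in> fspan x (E - P) \<longrightarrow> h = (\<lambda>_. 0)))"

text \<open>$N$ is a circuit of the matroid contraction by $P$, as in an ear decomposition.\<close>

lemma minimal_ear:
  assumes fin: "finite E" and P: "P \<subseteq> E" "P \<noteq> {}" "P \<noteq> E" and ns: "\<not> splits x E"
  obtains N c where "N \<subseteq> E - P" "N \<noteq> {}" "lcomb x N c \<in> fspan x P" "lcomb x N c \<noteq> (\<lambda>_. 0)"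
    "\<And>a. a \<in> N \<Longrightarrow> c a \<noteq> 0" "frank x P + card N \<le> frank x (P \<union> N) + 1"
proof -
  define Q where "Q N \<longleftrightarrow> N \<subseteq> E - P \<and> (\<exists>c. lcomb x N c \<in> fspan x P \<and> lcomb x N c \<noteq> (\<lambda>_. 0))" for N
  obtain h where h: "h \<in> fspan x P" "h \<in> fspan x (E - P)" "h \<noteq> (\<lambda>_. 0)"
    using ns P unfolding splits_def by blast
  then have "Q (E - P)" unfolding Q_def fspan_def[of x "E - P"] by blast
  then obtain N where N: "Q N" "\<And>N'. Q N' \<Longrightarrow> card N \<le> card N'"
    using ex_has_least_nat[of Q _ card] by blast
  obtain c where sub: "N \<subseteq> E - P" and c: "lcomb x N c \<in> fspan x P" "lcomb x N c \<noteq> (\<lambda>_. 0)"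
    using N(1) by (auto simp: Q_def)
  have finN: "finite N" and finP: "finite P" using sub P fin finite_subset by blast+
  have min: "lcomb x N' d = (\<lambda>_. 0)" if "N' \<subset> N" "lcomb x N' d \<in> fspan x P" for N' d
    using N(2)[of N'] that sub psubset_card_mono[OF finN that(1)] unfolding Q_def by fastforce
  \<comment> \<open>Claimed for every coefficient function representing the same vector, because a
    modified one is used below.\<close>
  have cnz: "d a \<noteq> 0" if "lcomb x N d = lcomb x N c" "a \<in> N" for d a
  proof
    assume "d a = 0"
    then have "lcomb x N d = lcomb x (N - {a}) d"
      by (intro lcomb_mono_neutral) (use finN in auto)
    then show False using min[of "N - {a}" d] that c by auto
  qed
  have rank: "frank x P + card N \<le> frank x (P \<union> N) + 1"
  proof -
    obtain N1 where N1: "N1 \<subseteq> N" "frank x (P \<union> N) = frank x P + card N1"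
      "\<And>a. a \<in> P \<union> N \<Longrightarrow> x a \<in> fspan x (P \<union> N1)"
      by (rule frank_basis_mod[of P N x]) (use finN finP in auto)
    have fN1: "finite N1" using N1 finN finite_subset by blast
    have "card N \<le> card N1 + 1"
    proof (cases "N1 = N")
      case False
      then obtain a where a: "a \<in> N" "a \<notin> N1" using N1 by blast
      \<comment> \<open>Otherwise expanding \<open>x a\<close> modulo \<open>P\<close> gives a
        combination over a proper subset of \<open>N\<close> lying in the span over
        \<open>P\<close>. By minimality it is zero, and subtracting \<open>c a\<close> times it from
        \<open>c\<close> removes the coefficient at \<open>a\<close>, against
        \<open>cnz\<close>.\<close>
      have "insert a N1 = N"
      proof (rule ccontr)
        assume ne: "insert a N1 \<noteq> N"
        obtain k e where k: "k \<in> fspan x P" "\<And>i. x a i = k i + lcomb x N1 e i"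
          using fspan_Un_cases[OF finP fN1 N1(3)[of a]] a by blast
        define d where "d b = (if b = a then 1 else if b \<in> N1 then - e b else 0)" for b
        have d: "lcomb x (insert a N1) d = k"
        proof
          fix i
          have "lcomb x (insert a N1) d i = x a i - lcomb x N1 e i"
            using fN1 a by (auto simp: lcomb_def d_def simp flip: sum_negf intro!: sum.cong)
          then show "lcomb x (insert a N1) d i = k i" using k(2) by simp
        qed
        then have "lcomb x (insert a N1) d = (\<lambda>_. 0)"
          using k(1) ne a N1(1) by (intro min) auto
        moreover have "lcomb x N d = lcomb x (insert a N1) d"
          by (rule lcomb_mono_neutral) (use finN a N1 in \<open>auto simp: d_def\<close>)
        ultimately have d0: "lcomb x N d = (\<lambda>_. 0)" by simp
        have "lcomb x N (\<lambda>b. c b - c a * d b) = lcomb x N c"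
        proof
          fix i
          have "lcomb x N (\<lambda>b. c b - c a * d b) i = lcomb x N c i - c a * lcomb x N d i"
            by (simp add: lcomb_def algebra_simps sum_subtractf sum_distrib_left)
          then show "lcomb x N (\<lambda>b. c b - c a * d b) i = lcomb x N c i" by (simp add: d0)
        qed
        from cnz[OF this a(1)] show False by (simp add: d_def)
      qed
      then show ?thesis using fN1 a by (metis add.commute card_insert_disjoint le_refl plus_1_eq_Suc)
    qed simp
    then show ?thesis using N1(2) by simp
  qed
  have "N \<noteq> {}" using c(2) by (auto simp: lcomb_def)
  show ?thesis by (rule that[OF sub \<open>N \<noteq> {}\<close> c cnz[OF refl] rank])
qed

lemma frank_singleton:
  assumes "x a \<noteq> (\<lambda>_. 0)" shows "frank x {a} = 1"
proof -
  have "frank x {a} = card {a}"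
    by (rule frank_eq_card) (use assms in \<open>auto simp: lcomb_def fun_eq_iff\<close>)
  then show ?thesis by simp
qed

text \<open>Ears are attached to a single vector until \<open>E\<close> is reached. An ear
  \<open>N\<close> raises the rank of \<open>x\<close> by at least \<open>card N - 1\<close>
  (\<open>minimal_ear\<close>) and the sum of the factor ranks by at most \<open>card N - 1\<close>
  (\<open>ear_step\<close>), so the inequality persists.\<close>

lemma frank_product:
  assumes fin: "finite E" "E \<noteq> {}" and prod: "is_product x u v"
    and nz: "\<And>a. a \<in> E \<Longrightarrow> x a \<noteq> (\<lambda>_. 0)" and ns: "\<not> splits x E"
  shows "frank u E + frank v E \<le> frank x E + 1"
proof -
  \<comment> \<open>A maximal member of \<open>G\<close> replaces an explicit ear decomposition,
    since an ear would enlarge it.\<close>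
  define G where "G = {P. P \<subseteq> E \<and> P \<noteq> {} \<and> frank u P + frank v P \<le> frank x P + 1}"
  obtain a where a: "a \<in> E" using fin by blast
  have "{a} \<in> G"
    using a frank_singleton[of x a] nz[of a] frank_le_card[of "{a}" u] frank_le_card[of "{a}" v]
    by (auto simp: G_def)
  moreover have "finite G" using fin(1) by (rule rev_finite_subset[OF finite_Pow_iff[THEN iffD2]]) (auto simp: G_def)
  ultimately obtain P where P: "P \<in> G" "\<And>P'. P' \<in> G \<Longrightarrow> P \<subseteq> P' \<Longrightarrow> P = P'"
    using finite_has_maximal[of G] by blast
  have "P = E"
  proof (rule ccontr)
    assume "P \<noteq> E"
    then obtain N c where N: "N \<subseteq> E - P" "N \<noteq> {}" "lcomb x N c \<in> fspan x P" "lcomb x N c \<noteq> (\<lambda>_. 0)"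
      "\<And>a. a \<in> N \<Longrightarrow> c a \<noteq> 0" "frank x P + card N \<le> frank x (P \<union> N) + 1"
      using minimal_ear[OF fin(1) _ _ _ ns, of P] P(1) by (auto simp: G_def)
    have "finite P" "finite N" using N(1) P(1) fin(1) finite_subset by (auto simp: G_def)
    from ear_step[OF prod this N(3-5)] have "P \<union> N \<in> G"
      using N P(1) by (auto simp: G_def)
    then have "P = P \<union> N" using P(2) by blast
    then show False using N(1,2) by blast
  qed
  then show ?thesis using P(1) by (simp add: G_def)
qed

section \<open>Product vectors with any number of factors\<close>

definition ptensor :: "nat \<Rightarrow> (nat \<Rightarrow> 'e \<Rightarrow> 'i \<Rightarrow> complex) \<Rightarrow> 'e \<Rightarrow> (nat \<Rightarrow> 'i) \<Rightarrow> complex" where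
  "ptensor d u a = tensor d (\<lambda>k. u k a)"

lemma ptensor_upd [simp]: "ptensor d u a (j(d := i)) = ptensor d u a j"
  by (auto simp: ptensor_def tensor_def intro!: prod.cong)

lemma ptensor_Suc: "ptensor (Suc d) u a z = u d a (z d) * ptensor d u a z"
  by (simp add: ptensor_def tensor_def mult.commute)

text \<open>The last factor splits off: a pair \<open>(i, j)\<close> is realised by writing
  \<open>i\<close> into slot \<open>d\<close> of \<open>j\<close>, a slot that the first
  \<open>d\<close> factors do not read.\<close>

lemma is_product_ptensor: "is_product (ptensor (Suc d) u) (u d) (ptensor d u)"
  unfolding is_product_def
proof (intro conjI allI)
  fix i j show "\<exists>z. \<forall>a. ptensor (Suc d) u a z = u d a i * ptensor d u a j"
    by (rule exI[of _ "j(d := i)"]) (simp add: ptensor_Suc)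
  fix z :: "nat \<Rightarrow> 'b"
  show "\<exists>i j. \<forall>a. ptensor (Suc d) u a z = u d a i * ptensor d u a j"
    by (rule exI[of _ "z d"], rule exI[of _ z]) (simp add: ptensor_Suc)
qed

text \<open>Fixing the \<open>u\<close>-coordinate of a vector common to both \<open>x\<close>-spans
  gives a vector common to both \<open>v\<close>-spans, which is zero. So connectedness passes from
  the tensors to the factor \<open>v\<close>.\<close>

lemma splits_product:
  assumes prod: "is_product x u v" and "splits v E"
  shows "splits x E"
proof -
  obtain P where P: "P \<subseteq> E" "P \<noteq> {}" "P \<noteq> E" "\<And>h. h \<in> fspan v P \<Longrightarrow> h \<in> fspan v (E - P) \<Longrightarrow> h = (\<lambda>_. 0)"
    using assms unfolding splits_def by blast
  have "h = (\<lambda>_. 0)" if h: "h \<in> fspan x P" "h \<in> fspan x (E - P)" for h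
  proof
    fix z
    obtain c where c: "h = lcomb x P c" using h by (auto simp: fspan_def)
    obtain i j where ij: "\<And>a. x a z = u a i * v a j"
      using prod unfolding is_product_def by blast
    have "lcomb v P (\<lambda>a. c a * u a i) \<in> fspan v (E - P)"
      using is_product_slice[OF is_product_swap[OF prod]] h(2) c by blast
    from fun_cong[OF P(4)[OF lcomb_in_fspan this], of j] show "h z = 0"
      by (simp add: c lcomb_def ij mult_ac)
  qed
  then show ?thesis using P unfolding splits_def by blast
qed

text \<open>Factors are peeled off one at a time by \<open>frank_product\<close>. The subtractions
  in 1 + sum of (d_k - 1) are moved across to stay in the natural numbers.\<close>

lemma frank_ptensor:
  assumes "finite E" "E \<noteq> {}" "\<And>a. a \<in> E \<Longrightarrow> ptensor d u a \<noteq> (\<lambda>_. 0)" "\<not> splits (ptensor d u) E"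
  shows "(\<Sum>k<d. frank (u k) E) + 1 \<le> frank (ptensor d u) E + d"
  using assms(3,4)
proof (induction d)
  \<comment> \<open>With no factors each tensor is the constant 1, so the rank is at least
    one.\<close>
  case 0
  obtain a where a: "a \<in> E" using assms(2) by blast
  have "frank (ptensor 0 u) {a} = 1" using 0 a by (intro frank_singleton)
  then show ?case using frank_mono[of E "{a}" "ptensor 0 u"] a assms(1) by simp
next
  case (Suc d)
  have "ptensor d u a \<noteq> (\<lambda>_. 0)" if "a \<in> E" for a
    using Suc.prems(1)[OF that] by (auto simp: fun_eq_iff ptensor_Suc)
  moreover have "\<not> splits (ptensor d u) E"
    using Suc.prems(2) splits_product[OF is_product_ptensor] by blast
  moreover have "frank (u d) E + frank (ptensor d u) E \<le> frank (ptensor (Suc d) u) E + 1"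
    by (rule frank_product[OF assms(1,2) is_product_ptensor Suc.prems])
  ultimately show ?case using Suc.IH by force
qed

subsection \<open>Matching two decompositions\<close>

text \<open>Transfers Kruskal's condition from \<open>r\<close> to \<open>n\<close> terms. If
  \<open>K k \<ge> n\<close> for at least three indices, these alone give \<open>3 * (n - 1)\<close>
  above \<open>d\<close>, enough as \<open>n \<ge> 2\<close>. Otherwise truncation lowers at most
  two summands, each by at most \<open>r - n\<close>.\<close>

lemma sum_min_krank:
  fixes K :: "nat \<Rightarrow> nat"
  assumes K: "\<And>k. k < d \<Longrightarrow> 1 \<le> K k \<and> K k \<le> r"
    and sumK: "2 * r + d \<le> (\<Sum>k<d. K k) + 1" and n: "2 \<le> n" "n \<le> r"
  shows "2 * n + d \<le> (\<Sum>k<d. min (K k) n) + 1"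
proof -
  define T where "T = {k. k < d \<and> n \<le> K k}"
  have T: "T \<subseteq> {..<d}" by (auto simp: T_def)
  have *: "(\<Sum>k<d. if k \<in> T then c else 0) = card T * c" for c :: nat
  proof -
    have "(\<Sum>k<d. if k \<in> T then c else 0) = (\<Sum>k\<in>{..<d} \<inter> T. c)"
      by (rule sum.inter_restrict[symmetric]) simp
    then show ?thesis using T by (simp add: Int_absorb1)
  qed
  show ?thesis
  proof (cases "3 \<le> card T")
    case True
    have "(\<Sum>k<d. 1 + (if k \<in> T then n - 1 else 0)) \<le> (\<Sum>k<d. min (K k) n)"
      by (rule sum_mono) (use K n in \<open>auto simp: T_def\<close>)
    then have "d + card T * (n - 1) \<le> (\<Sum>k<d. min (K k) n)"
      by (simp only: sum.distrib *) simp
    moreover have "3 * (n - 1) \<le> card T * (n - 1)" using True by (rule mult_le_mono1)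
    ultimately show ?thesis using n by linarith
  next
    case False
    have "(\<Sum>k<d. K k) \<le> (\<Sum>k<d. min (K k) n + (if k \<in> T then r - n else 0))"
      by (rule sum_mono) (use K n in \<open>auto simp: T_def\<close>)
    then have "(\<Sum>k<d. K k) \<le> (\<Sum>k<d. min (K k) n) + card T * (r - n)"
      by (simp only: sum.distrib *)
    moreover have "card T * (r - n) \<le> 2 * (r - n)" using False by (intro mult_le_mono1) simp
    ultimately show ?thesis using n sumK by linarith
  qed
qed

lemma ptensor_nonzero:
  assumes "\<And>k. k < d \<Longrightarrow> u k a \<noteq> (\<lambda>_. 0)"
  shows "ptensor d u a \<noteq> (\<lambda>_. 0)"
proof -
  have "\<exists>i. u k a i \<noteq> 0" if "k < d" for k using assms[OF that] by auto
  then obtain z where "\<And>k. k < d \<Longrightarrow> u k a (z k) \<noteq> 0" by metis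
  then have "ptensor d u a z \<noteq> 0" by (simp add: ptensor_def tensor_def)
  then show ?thesis by auto
qed

text \<open>The sign on \<open>B\<close> makes the equality of two decompositions a single relation
  on \<open>A \<union> B\<close>, whose restriction to \<open>Q\<close> measures the imbalance
  inside \<open>Q\<close>.\<close>

lemma lcomb_Int_signed:
  assumes "finite A" "finite B" "A \<inter> B = {}" "Q \<subseteq> A \<union> B"
  shows "lcomb x Q (\<lambda>e. if e \<in> A then l e else - l e) z = lcomb x (A \<inter> Q) l z - lcomb x (B \<inter> Q) l z"
proof -
  have Q: "Q = (A \<inter> Q) \<union> (B \<inter> Q)" using assms by blast
  have "lcomb x Q (\<lambda>e. if e \<in> A then l e else - l e) z =
    (\<Sum>e\<in>A \<inter> Q. (if e \<in> A then l e else - l e) * x e z) + (\<Sum>e\<in>B \<inter> Q. (if e \<in> A then l e else - l e) * x e z)"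
    unfolding lcomb_def by (subst Q, subst sum.union_disjoint) (use assms in auto)
  also have "(\<Sum>e\<in>A \<inter> Q. (if e \<in> A then l e else - l e) * x e z) = lcomb x (A \<inter> Q) l z"
    unfolding lcomb_def by (intro sum.cong) auto
  also have "(\<Sum>e\<in>B \<inter> Q. (if e \<in> A then l e else - l e) * x e z) = - lcomb x (B \<inter> Q) l z"
    unfolding lcomb_def sum_negf[symmetric] using assms by (intro sum.cong) auto
  finally show ?thesis by simp
qed

text \<open>The restrictions of the relation to the two parts are opposite vectors, so each lies in
  both spans and vanishes: both parts are balanced.\<close>

lemma split_relation:
  assumes fin: "finite A" "finite B" and disj: "A \<inter> B = {}"
    and rel: "lcomb x A l = lcomb x B l" and spl: "splits x (A \<union> B)"
  obtains Q where "Q \<subseteq> A \<union> B" "Q \<noteq> {}" "Q \<noteq> A \<union> B"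
    "lcomb x (A \<inter> Q) l = lcomb x (B \<inter> Q) l" "lcomb x (A - Q) l = lcomb x (B - Q) l"
proof -
  let ?c = "\<lambda>e. if e \<in> A then l e else - l e"
  obtain P where P: "P \<subseteq> A \<union> B" "P \<noteq> {}" "P \<noteq> A \<union> B"
    "\<And>h. h \<in> fspan x P \<Longrightarrow> h \<in> fspan x (A \<union> B - P) \<Longrightarrow> h = (\<lambda>_. 0)"
    using spl unfolding splits_def by blast
  have "lcomb x P ?c z = 0 - lcomb x (A \<union> B - P) ?c z" for z
  proof -
    have "lcomb x (A \<union> B) ?c z = 0"
      using lcomb_Int_signed[of A B "A \<union> B" x l z] assms by (simp add: Int_absorb2)
    moreover have "lcomb x (A \<union> B) ?c z = lcomb x (A \<union> B - P) ?c z + lcomb x P ?c z"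
      unfolding lcomb_def using P fin by (intro sum.subset_diff) auto
    ultimately show ?thesis by (simp add: add_eq_0_iff)
  qed
  then have eq: "lcomb x P ?c = (\<lambda>z. 0 - lcomb x (A \<union> B - P) ?c z)" by blast
  then have "lcomb x P ?c \<in> fspan x (A \<union> B - P)"
    by (simp only: eq) (intro fspan_diff zero_in_fspan lcomb_in_fspan)
  then have 0: "lcomb x P ?c = (\<lambda>_. 0)" using P(4) by simp
  with eq have 1: "lcomb x (A \<union> B - P) ?c = (\<lambda>_. 0)" by (simp add: fun_eq_iff)
  have "lcomb x (A \<inter> P) l = lcomb x (B \<inter> P) l"
    using lcomb_Int_signed[OF fin disj P(1), of x l] 0 by (auto simp: fun_eq_iff)
  moreover have "A \<inter> (A \<union> B - P) = A - P" "B \<inter> (A \<union> B - P) = B - P" by auto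
  then have "lcomb x (A - P) l = lcomb x (B - P) l"
    using lcomb_Int_signed[OF fin disj, of "A \<union> B - P" x l] 1 by (auto simp: fun_eq_iff)
  ultimately show ?thesis using that P by blast
qed

text \<open>\<open>A0\<close> holds the \<open>r\<close> given terms and stays fixed, while
  \<open>A\<close> shrinks in the induction on the number of terms. If \<open>A \<union> B\<close>
  did not split, \<open>frank_ptensor\<close> and \<open>sum_min_krank\<close> would make its rank
  at least \<open>2 * card A\<close>, but the relation keeps it below
  \<open>card (A \<union> B)\<close>. Allowing \<open>B\<close> to be smaller than \<open>A\<close>
  settles rank and uniqueness together.\<close>

theorem kruskal_matching:
  fixes K :: "nat \<Rightarrow> nat"
  assumes K: "\<And>k. k < d \<Longrightarrow> 1 \<le> K k \<and> K k \<le> r"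
    and sumK: "2 * r + d \<le> (\<Sum>k<d. K k) + 1"
    and A0: "finite A0" "card A0 = r"
    and indep: "\<And>k S. k < d \<Longrightarrow> S \<subseteq> A0 \<Longrightarrow> card S \<le> K k \<Longrightarrow> frank (u k) S = card S"
    and l: "\<And>a. a \<in> A0 \<Longrightarrow> l a \<noteq> 0"
    and A: "A \<subseteq> A0" and "finite B" "A \<inter> B = {}" "card B \<le> card A"
    and "lcomb (ptensor d u) A l = lcomb (ptensor d u) B l"
  shows "\<exists>h. bij_betw h A B \<and> (\<forall>a\<in>A. \<forall>z. l a * ptensor d u a z = l (h a) * ptensor d u (h a) z)"
  using assms(7-11)
proof (induction "card (A \<union> B)" arbitrary: A B rule: less_induct)
  case less
  let ?x = "ptensor d u"
  note prems = less.prems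
  have finA: "finite A" using prems(1) A0(1) finite_subset by blast
  have IH: "\<exists>h. bij_betw h A' B' \<and> (\<forall>a\<in>A'. \<forall>z. l a * ?x a z = l (h a) * ?x (h a) z)"
    if "A' \<subseteq> A" "B' \<subseteq> B" "A' \<union> B' \<noteq> A \<union> B" "card B' \<le> card A'" "lcomb ?x A' l = lcomb ?x B' l" for A' B'
  proof (rule less.hyps)
    have "A' \<union> B' \<subset> A \<union> B" using that by blast
    then show "card (A' \<union> B') < card (A \<union> B)" using finA prems(2) by (intro psubset_card_mono) auto
    show "A' \<subseteq> A0" using that prems by blast
    show "finite B'" using that prems finite_subset by blast
    show "A' \<inter> B' = {}" using that prems by blast
  qed (use that in auto)
  have xA: "?x a \<noteq> (\<lambda>_. 0)" if "a \<in> A" for a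
  proof (rule ptensor_nonzero)
    fix k assume k: "k < d"
    have "frank (u k) {a} = 1" using indep[OF k, of "{a}"] K[OF k] that prems(1) by auto
    then show "u k a \<noteq> (\<lambda>_. 0)" using frank_less_card[of "{a}" "u k" "\<lambda>_. 1" a] by (auto simp: lcomb_def)
  qed
  have cardA: "card A \<le> r" using A0 prems(1) card_mono by blast
  \<comment> \<open>A single term is treated by hand, as \<open>sum_min_krank\<close> needs at least
    two.\<close>
  consider "A = {}" | a where "A = {a}" | "2 \<le> card A"
  proof -
    have "card A = 0 \<or> card A = 1 \<or> 2 \<le> card A" by linarith
    then show ?thesis using that finA by (metis card_0_eq card_1_singletonE)
  qed
  then show ?case
  proof cases
    case 1
    then show ?thesis using prems by (auto simp: bij_betw_def)
  next
    case 2
    have "B \<noteq> {}"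
    proof
      assume "B = {}"
      then have "l a * ?x a z = 0" for z
        using fun_cong[OF prems(5), of z] 2 by (simp add: lcomb_def)
      then show False using l[of a] xA[of a] 2 prems(1) by auto
    qed
    moreover have "card B \<le> 1" using prems 2 by simp
    ultimately obtain b where B: "B = {b}"
      using prems(2) by (metis card_0_eq card_1_singletonE le_neq_implies_less less_one)
    have "l a * ?x a z = l b * ?x b z" for z
      using fun_cong[OF prems(5), of z] 2 B by (simp add: lcomb_def)
    then show ?thesis using 2 B by (intro exI[of _ "\<lambda>_. b"]) (auto simp: bij_betw_def)
  next
    case 3
    show ?thesis
    proof (cases "\<exists>b\<in>B. ?x b = (\<lambda>_. 0)")
      \<comment> \<open>\<open>frank_ptensor\<close> applies to nonzero tensors. Dropping a zero
        term would match \<open>A\<close> with a set smaller than \<open>B\<close>, contradicting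
        \<open>card B \<le> card A\<close>.\<close>
      case True
      then obtain b where b: "b \<in> B" "?x b = (\<lambda>_. 0)" by blast
      have "lcomb ?x B l = lcomb ?x (B - {b}) l"
        unfolding lcomb_def
        by (intro ext sum.mono_neutral_right) (use b prems(2) in \<open>auto simp: fun_eq_iff\<close>)
      moreover have "card (B - {b}) < card B" using b prems(2) by (intro card_Diff1_less)
      moreover have "A \<union> (B - {b}) \<noteq> A \<union> B" using b prems(3) by auto
      ultimately obtain h where "bij_betw h A (B - {b})"
        using IH[of A "B - {b}"] prems(4,5) by auto
      then have "card A = card (B - {b})" by (rule bij_betw_same_card)
      then show ?thesis using \<open>card (B - {b}) < card B\<close> prems(4) by simp
    next
      case False
      have finE: "finite (A \<union> B)" using finA prems by simp
      have "splits ?x (A \<union> B)"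
      proof (rule ccontr)
        assume "\<not> splits ?x (A \<union> B)"
        then have 1: "(\<Sum>k<d. frank (u k) (A \<union> B)) + 1 \<le> frank ?x (A \<union> B) + d"
          using 3 finE xA False by (intro frank_ptensor) auto
        obtain a where a: "a \<in> A" using 3 by fastforce
        have "lcomb ?x (A \<union> B) (\<lambda>e. if e \<in> A then l e else - l e) = (\<lambda>_. 0)"
          using lcomb_Int_signed[of A B "A \<union> B" ?x l] prems finA by (auto simp: fun_eq_iff Int_absorb2)
        then have 2: "frank ?x (A \<union> B) < card (A \<union> B)"
          by (rule frank_less_card[OF finE, of _ _ a]) (use a l prems(1) in auto)
        have 4: "card (A \<union> B) \<le> 2 * card A"
          using card_Un_le[of A B] prems(4) by linarith
        have 5: "min (K k) (card A) \<le> frank (u k) (A \<union> B)" if k: "k < d" for k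
        proof -
          obtain S where S: "S \<subseteq> A" "card S = min (K k) (card A)"
            using obtain_subset_with_card_n[of "min (K k) (card A)" A] by auto
          then have "frank (u k) S = min (K k) (card A)" using indep[OF k, of S] prems(1) by auto
          then show ?thesis using frank_mono[OF finE, of S "u k"] S by auto
        qed
        have "2 * card A + d \<le> (\<Sum>k<d. min (K k) (card A)) + 1"
          by (rule sum_min_krank[OF K sumK 3 cardA])
        also have "(\<Sum>k<d. min (K k) (card A)) \<le> (\<Sum>k<d. frank (u k) (A \<union> B))"
          by (rule sum_mono) (use 5 in auto)
        finally show False using 1 2 4 by linarith
      qed
      then obtain P where P: "P \<subseteq> A \<union> B" "P \<noteq> {}" "P \<noteq> A \<union> B"
        "lcomb ?x (A \<inter> P) l = lcomb ?x (B \<inter> P) l" "lcomb ?x (A - P) l = lcomb ?x (B - P) l"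
        using split_relation[OF finA prems(2,3,5)] by blast
      have cards: "card (A \<inter> P) + card (A - P) = card A" "card (B \<inter> P) + card (B - P) = card B"
        using finA prems(2) by (metis card_Diff_subset_Int card_mono finite_Int inf_le1 le_add_diff_inverse)+
      \<comment> \<open>One of the two sides has at least as many terms from \<open>A\<close> as
        from \<open>B\<close>. Matching it first makes its counts equal, so the inequality passes to
        the other side.\<close>
      obtain Q where Q: "Q \<subseteq> A \<union> B" "Q \<noteq> {}" "Q \<noteq> A \<union> B"
        "lcomb ?x (A \<inter> Q) l = lcomb ?x (B \<inter> Q) l" "lcomb ?x (A - Q) l = lcomb ?x (B - Q) l"
        "card (B \<inter> Q) \<le> card (A \<inter> Q)"
      proof (cases "card (B \<inter> P) \<le> card (A \<inter> P)")
        case True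
        then show ?thesis using that P by blast
      next
        case False
        let ?Q = "A \<union> B - P"
        have *: "A \<inter> ?Q = A - P" "B \<inter> ?Q = B - P" "A - ?Q = A \<inter> P" "B - ?Q = B \<inter> P" by auto
        have "card (B - P) \<le> card (A - P)" using False cards prems(4) by linarith
        then show ?thesis by (intro that[of ?Q]) (use P in \<open>auto simp: *\<close>)
      qed
      obtain h where h: "bij_betw h (A \<inter> Q) (B \<inter> Q)"
        "\<forall>a\<in>A \<inter> Q. \<forall>z. l a * ?x a z = l (h a) * ?x (h a) z"
        using IH[of "A \<inter> Q" "B \<inter> Q"] Q by blast
      have "card (A \<inter> Q) = card (B \<inter> Q)" using h(1) by (rule bij_betw_same_card)
      moreover have "card (A \<inter> Q) + card (A - Q) = card A" "card (B \<inter> Q) + card (B - Q) = card B"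
        using finA prems(2) by (metis card_Diff_subset_Int card_mono finite_Int inf_le1 le_add_diff_inverse)+
      ultimately have "card (B - Q) \<le> card (A - Q)" using prems(4) by linarith
      then obtain h' where h': "bij_betw h' (A - Q) (B - Q)"
        "\<forall>a\<in>A - Q. \<forall>z. l a * ?x a z = l (h' a) * ?x (h' a) z"
        using IH[of "A - Q" "B - Q"] Q by blast
      have "bij_betw (\<lambda>a. if a \<in> A \<inter> Q then h a else h' a) (A \<inter> Q \<union> (A - Q)) (B \<inter> Q \<union> (B - Q))"
        by (rule bij_betw_disjoint_Un[OF h(1) h'(1)]) auto
      moreover have "A \<inter> Q \<union> (A - Q) = A" "B \<inter> Q \<union> (B - Q) = B" by auto
      ultimately show ?thesis using h(2) h'(2)
        by (intro exI[of _ "\<lambda>a. if a \<in> A \<inter> Q then h a else h' a"]) auto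
    qed
  qed
qed

subsection \<open>From $L^2$ to Gram coordinates\<close>

lemma measurable_cnj:
  assumes "h \<in> borel_measurable M" shows "(\<lambda>x. cnj (h x)) \<in> borel_measurable M"
  using assms by (rule measurable_compose) (intro borel_measurable_continuous_onI continuous_intros)

lemma integrable_L2_inner:
  assumes "memL2 M g" "memL2 M h"
  shows "integrable M (\<lambda>x. g x * cnj (h x))"
proof (rule Bochner_Integration.integrable_bound)
  show "integrable M (\<lambda>x. (cmod (g x))\<^sup>2 + (cmod (h x))\<^sup>2)"
    using assms by (auto simp: memL2_def)
  have "g \<in> borel_measurable M" "h \<in> borel_measurable M" using assms by (auto simp: memL2_def)
  then show "(\<lambda>x. g x * cnj (h x)) \<in> borel_measurable M"
    by (intro borel_measurable_times measurable_cnj)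
  show "AE x in M. norm (g x * cnj (h x)) \<le> norm ((cmod (g x))\<^sup>2 + (cmod (h x))\<^sup>2)"
  proof (rule AE_I2)
    fix x
    have "2 * (cmod (g x) * cmod (h x)) \<le> (cmod (g x))\<^sup>2 + (cmod (h x))\<^sup>2"
      using sum_squares_bound[of "cmod (g x)" "cmod (h x)"] by simp
    moreover have "0 \<le> cmod (g x) * cmod (h x)" by simp
    ultimately show "norm (g x * cnj (h x)) \<le> norm ((cmod (g x))\<^sup>2 + (cmod (h x))\<^sup>2)"
      unfolding norm_mult complex_mod_cnj real_norm_def by linarith
  qed
qed

lemma L2_inner_self: "L2_norm M g = 1 \<Longrightarrow> L2_inner M g g = 1"
  by (simp add: L2_norm_def L2_inner_def flip: complex_norm_square of_real_power)

lemma L2_inner_sum: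
  assumes "\<And>a. a \<in> S \<Longrightarrow> integrable M (\<lambda>x. g a x * cnj (h x))"
  shows "integrable M (\<lambda>x. (\<Sum>a\<in>S. c a * g a x) * cnj (h x))"
    and "L2_inner M (\<lambda>x. \<Sum>a\<in>S. c a * g a x) h = (\<Sum>a\<in>S. c a * L2_inner M (g a) h)"
proof -
  have *: "(\<lambda>x. (\<Sum>a\<in>S. c a * g a x) * cnj (h x)) = (\<lambda>x. \<Sum>a\<in>S. c a * (g a x * cnj (h x)))"
    by (simp add: sum_distrib_right mult.assoc)
  show "integrable M (\<lambda>x. (\<Sum>a\<in>S. c a * g a x) * cnj (h x))"
    unfolding * using assms by (intro Bochner_Integration.integrable_sum integrable_mult_right) auto
  show "L2_inner M (\<lambda>x. \<Sum>a\<in>S. c a * g a x) h = (\<Sum>a\<in>S. c a * L2_inner M (g a) h)"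
    unfolding L2_inner_def * using assms
    by (subst Bochner_Integration.integral_sum) (auto intro!: integrable_mult_right)
qed

text \<open>The squared norm of a combination \<open>F\<close> is a combination of its inner
  products with the members, all zero. Integrability is asked of the products only, so the lemma
  serves factors and tensors alike.\<close>

lemma AE_zero_if_orthogonal:
  assumes meas: "\<And>a. a \<in> S \<Longrightarrow> g a \<in> borel_measurable M"
    and int: "\<And>a b. a \<in> S \<Longrightarrow> b \<in> S \<Longrightarrow> integrable M (\<lambda>x. g a x * cnj (g b x))"
    and orth: "\<And>b. b \<in> S \<Longrightarrow> (\<Sum>a\<in>S. c a * L2_inner M (g a) (g b)) = 0"
  shows "AE x in M. (\<Sum>a\<in>S. c a * g a x) = 0"
proof -
  define F where "F x = (\<Sum>a\<in>S. c a * g a x)" for x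
  have FF: "F x * cnj (F x) = (\<Sum>b\<in>S. cnj (c b) * (F x * cnj (g b x)))" for x
    by (subst (2) F_def) (simp add: sum_distrib_left mult_ac)
  have intF: "integrable M (\<lambda>x. F x * cnj (g b x))" if "b \<in> S" for b
    unfolding F_def by (rule L2_inner_sum(1)) (use int that in auto)
  have zero: "(\<integral>x. F x * cnj (g b x) \<partial>M) = 0" if "b \<in> S" for b
    using L2_inner_sum(2)[of S M g "g b" c] int orth[OF that] that
    by (simp add: L2_inner_def F_def)
  have "integrable M (\<lambda>x. F x * cnj (F x))"
    unfolding FF by (intro Bochner_Integration.integrable_sum integrable_mult_right intF)
  then have "integrable M (\<lambda>x. (cmod (F x))\<^sup>2)"
    unfolding complex_norm_square[symmetric] complex_of_real_integrable_eq .
  moreover have "(\<integral>x. F x * cnj (F x) \<partial>M) = 0"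
    unfolding FF using intF zero
    by (subst Bochner_Integration.integral_sum) (auto intro!: integrable_mult_right)
  then have "(\<integral>x. (cmod (F x))\<^sup>2 \<partial>M) = 0"
    unfolding complex_norm_square[symmetric] integral_complex_of_real by (simp only: of_real_eq_0_iff)
  ultimately have "AE x in M. (cmod (F x))\<^sup>2 = 0"
    by (subst (asm) integral_nonneg_eq_0_iff_AE) auto
  then show ?thesis by (simp add: F_def)
qed

section \<open>Tensors on the product measure space\<close>

lemma tensor_measurable:
  assumes "\<And>k. k < d \<Longrightarrow> memL2 (M k) (g k)"
  shows "tensor d g \<in> borel_measurable (prodM d M)"
proof -
  have "(\<lambda>x. g k (x k)) \<in> borel_measurable (prodM d M)" if "k < d" for k
    using assms[OF that] that unfolding prodM_def memL2_def
    by (intro measurable_compose[OF measurable_component_singleton]) auto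
  then show ?thesis unfolding tensor_def[abs_def] by (intro borel_measurable_prod) auto
qed

lemma tensor_inner:
  assumes sigma: "\<And>k. k < d \<Longrightarrow> sigma_finite_measure (M k)"
    and g: "\<And>k. k < d \<Longrightarrow> memL2 (M k) (g k)" and h: "\<And>k. k < d \<Longrightarrow> memL2 (M k) (h k)"
  shows "integrable (prodM d M) (\<lambda>x. tensor d g x * cnj (tensor d h x))"
    and "L2_inner (prodM d M) (tensor d g) (tensor d h) = (\<Prod>k<d. L2_inner (M k) (g k) (h k))"
proof -
  \<comment> \<open>The locale demands sigma-finiteness at all indices; the empty space fills those
    from \<open>d\<close> on.\<close>
  define N where "N k = (if k < d then M k else count_space {})" for k
  have prodM: "prodM d M = Pi\<^sub>M {..<d} N"
    unfolding prodM_def by (intro PiM_cong) (auto simp: N_def)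
  have "sigma_finite_measure (N k)" for k
    using sigma by (auto simp: N_def intro: sigma_finite_measure_count_space_finite)
  then interpret product_sigma_finite N by (rule product_sigma_finite.intro)
  have eq: "tensor d g x * cnj (tensor d h x) = (\<Prod>k<d. g k (x k) * cnj (h k (x k)))" for x
    by (simp add: tensor_def prod.distrib)
  have int: "integrable (N k) (\<lambda>x. g k x * cnj (h k x))" if "k \<in> {..<d}" for k
    using that integrable_L2_inner[of "M k" "g k" "h k", OF g h] by (simp add: N_def)
  show "integrable (prodM d M) (\<lambda>x. tensor d g x * cnj (tensor d h x))"
    unfolding prodM eq by (rule product_integrable_prod[OF _ int]) auto
  show "L2_inner (prodM d M) (tensor d g) (tensor d h) = (\<Prod>k<d. L2_inner (M k) (g k) (h k))"
    unfolding prodM L2_inner_def eq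
    by (subst product_integral_prod[OF _ int]) (auto simp: N_def)
qed

text \<open>The second index $i$ is the coordinate; setting out-of-range coordinates to $0$ avoids the junk
  inner products with functions not known to be in $L^2$.\<close>

definition gram :: "(nat \<Rightarrow> 'a measure) \<Rightarrow> nat \<Rightarrow> (nat \<Rightarrow> nat \<Rightarrow> 'a \<Rightarrow> complex) \<Rightarrow> nat \<Rightarrow> nat \<Rightarrow> nat \<Rightarrow> complex" where
  "gram M n g k e i = (if i < n then L2_inner (M k) (g k e) (g k i) else 0)"

text \<open>A vanishing combination of Gram vectors comes from a function orthogonal to every
  member, hence null. So independence survives the passage to Gram coordinates.\<close>

lemma frank_gram:
  assumes g: "\<And>e. e < n \<Longrightarrow> memL2 (M k) (g k e)" and S: "S \<subseteq> {..<n}"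
    and indep: "lin_indep_L2 (M k) (g k) S"
  shows "frank (gram M n g k) S = card S"
proof (rule frank_eq_card)
  show "finite S" using S finite_subset by blast
  fix c a assume c: "lcomb (gram M n g k) S c = (\<lambda>_. 0)" and a: "a \<in> S"
  have "AE x in M k. (\<Sum>a\<in>S. c a * g k a x) = 0"
  proof (rule AE_zero_if_orthogonal)
    fix a b assume "a \<in> S" "b \<in> S"
    then show "integrable (M k) (\<lambda>x. g k a x * cnj (g k b x))"
      using S g by (intro integrable_L2_inner) auto
  next
    fix a assume "a \<in> S"
    then show "g k a \<in> borel_measurable (M k)" using S g[of a] by (auto simp: memL2_def)
    show "(\<Sum>b\<in>S. c b * L2_inner (M k) (g k b) (g k a)) = 0"
      using fun_cong[OF c, of a] \<open>a \<in> S\<close> S by (auto simp: lcomb_def gram_def)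
  qed
  then show "c a = 0" using indep a by (auto simp: lin_indep_L2_def)
qed

section \<open>Almost-everywhere identities in Gram coordinates\<close>

context
  fixes d n :: nat and M :: "nat \<Rightarrow> 'a measure" and g :: "nat \<Rightarrow> nat \<Rightarrow> 'a \<Rightarrow> complex"
  assumes sigma: "\<And>k. k < d \<Longrightarrow> sigma_finite_measure (M k)"
    and g: "\<And>k e. k < d \<Longrightarrow> e < n \<Longrightarrow> memL2 (M k) (g k e)"
begin

lemma ptensor_gram:
  assumes "\<And>k. k < d \<Longrightarrow> i k < n" "e < n"
  shows "ptensor d (gram M n g) e i = L2_inner (prodM d M) (tensor d (\<lambda>k. g k e)) (tensor d (\<lambda>k. g k (i k)))"
  using assms by (subst tensor_inner(2)) (auto simp: sigma g ptensor_def tensor_def gram_def)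

text \<open>The coordinate \<open>i\<close> is the inner product with the mixed tensor whose factors
  are \<open>g k (i k)\<close>, and inner products respect almost-everywhere equality. If some
  \<open>i k\<close> is out of range, both sides are 0.\<close>

lemma lcomb_ptensor_gram:
  assumes A: "A \<subseteq> {..<n}" and B: "B \<subseteq> {..<n}"
    and ae: "AE x in prodM d M. (\<Sum>e\<in>A. l e * tensor d (\<lambda>k. g k e) x) = (\<Sum>e\<in>B. l e * tensor d (\<lambda>k. g k e) x)"
  shows "lcomb (ptensor d (gram M n g)) A l = lcomb (ptensor d (gram M n g)) B l"
proof
  fix i :: "nat \<Rightarrow> nat"
  show "lcomb (ptensor d (gram M n g)) A l i = lcomb (ptensor d (gram M n g)) B l i"
  proof (cases "\<forall>k<d. i k < n")
    case True
    let ?h = "tensor d (\<lambda>k. g k (i k))"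
    let ?F = "\<lambda>C x. \<Sum>e\<in>C. l e * tensor d (\<lambda>k. g k e) x"
    have eq: "L2_inner (prodM d M) (?F C) ?h = lcomb (ptensor d (gram M n g)) C l i" if "C \<subseteq> {..<n}" for C
    proof -
      have "L2_inner (prodM d M) (?F C) ?h = (\<Sum>e\<in>C. l e * L2_inner (prodM d M) (tensor d (\<lambda>k. g k e)) ?h)"
        by (rule L2_inner_sum(2)) (rule tensor_inner(1)[OF sigma], use g True that in auto)
      also have "\<dots> = lcomb (ptensor d (gram M n g)) C l i"
        unfolding lcomb_def using True that by (intro sum.cong refl, subst ptensor_gram) auto
      finally show ?thesis .
    qed
    have meas: "tensor d (\<lambda>k. g k e) \<in> borel_measurable (prodM d M)" if "e < n" for e
      by (rule tensor_measurable) (use g that in auto)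
    have hm: "?h \<in> borel_measurable (prodM d M)"
      by (rule tensor_measurable) (use g True in auto)
    have Fm: "?F C \<in> borel_measurable (prodM d M)" if "C \<subseteq> {..<n}" for C
      using meas that by (intro borel_measurable_sum borel_measurable_times) auto
    have "L2_inner (prodM d M) (?F A) ?h = L2_inner (prodM d M) (?F B) ?h"
      unfolding L2_inner_def
    proof (rule integral_cong_AE)
      have "(\<lambda>x. cnj (?h x)) \<in> borel_measurable (prodM d M)" using hm by (rule measurable_cnj)
      then show "(\<lambda>x. ?F A x * cnj (?h x)) \<in> borel_measurable (prodM d M)"
        "(\<lambda>x. ?F B x * cnj (?h x)) \<in> borel_measurable (prodM d M)"
        using Fm A B by (auto intro!: borel_measurable_times)
      show "AE x in prodM d M. ?F A x * cnj (?h x) = ?F B x * cnj (?h x)"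
        using ae by eventually_elim simp
    qed
    then show ?thesis using eq A B by simp
  next
    case False
    then obtain k where "k < d" "\<not> i k < n" by blast
    then have "ptensor d (gram M n g) e i = 0" for e
      unfolding ptensor_def tensor_def by (intro prod_zero bexI[of _ k]) (auto simp: gram_def)
    then show ?thesis by (simp add: lcomb_def)
  qed
qed

text \<open>The converse for two single terms: the constant coordinates \<open>\<lambda>_. e\<close>
  with \<open>e\<close> in \<open>{a, b}\<close> show that their difference is orthogonal to both
  tensors.\<close>

lemma AE_eq_if_ptensor_gram_eq:
  assumes ab: "a < n" "b < n" "a \<noteq> b"
    and eq: "\<And>z. l a * ptensor d (gram M n g) a z = l b * ptensor d (gram M n g) b z"
  shows "AE x in prodM d M. l a * tensor d (\<lambda>k. g k a) x = l b * tensor d (\<lambda>k. g k b) x"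
proof -
  let ?c = "\<lambda>e. if e = a then l a else - l b"
  have "AE x in prodM d M. (\<Sum>e\<in>{a,b}. ?c e * tensor d (\<lambda>k. g k e) x) = 0"
  proof (rule AE_zero_if_orthogonal)
    fix e e' assume "e \<in> {a, b}" "e' \<in> {a, b}"
    then have "e < n" "e' < n" using ab by auto
    then show "integrable (prodM d M) (\<lambda>x. tensor d (\<lambda>k. g k e) x * cnj (tensor d (\<lambda>k. g k e') x))"
      by (intro tensor_inner(1) sigma g)
  next
    fix e assume "e \<in> {a, b}"
    then have e: "e < n" using ab by auto
    then show "tensor d (\<lambda>k. g k e) \<in> borel_measurable (prodM d M)"
      by (intro tensor_measurable g)
    show "(\<Sum>e'\<in>{a,b}. ?c e' * L2_inner (prodM d M) (tensor d (\<lambda>k. g k e')) (tensor d (\<lambda>k. g k e))) = 0"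
      using eq[of "\<lambda>_. e"] ab e by (simp add: ptensor_gram)
  qed
  then show ?thesis using ab by simp
qed

end

text \<open>Stated for \<open>s \<le> r\<close>, so that the bijection also excludes shorter
  decompositions.\<close>

lemma kruskal_L2:
  fixes K :: "nat \<Rightarrow> nat" and M :: "nat \<Rightarrow> 'a measure"
  assumes sigma: "\<And>k. k < d \<Longrightarrow> sigma_finite_measure (M k)"
    and dec: "is_decomp d M f r lam \<phi>" "is_decomp d M f s lam' \<psi>" and s: "s \<le> r"
    and nonzero: "\<And>p. p < r \<Longrightarrow> lam p \<noteq> 0"
    and K: "\<And>k. k < d \<Longrightarrow> 1 \<le> K k \<and> K k \<le> r" and sumK: "2 * r + d \<le> (\<Sum>k<d. K k) + 1"
    and indep: "\<And>k S. k < d \<Longrightarrow> S \<subseteq> {..<r} \<Longrightarrow> card S \<le> K k \<Longrightarrow> lin_indep_L2 (M k) (\<phi> k) S"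
  shows "\<exists>\<pi>. bij_betw \<pi> {..<s} {..<r} \<and> (\<forall>p<s. AE x in prodM d M.
    lam' p * tensor d (\<lambda>k. \<psi> k p) x = lam (\<pi> p) * tensor d (\<lambda>k. \<phi> k (\<pi> p)) x)"
proof -
  \<comment> \<open>Both decompositions form one family: the second is shifted by \<open>r\<close>,
    which keeps the index sets disjoint even when terms coincide.\<close>
  define g where "g k e = (if e < r then \<phi> k e else \<psi> k (e - r))" for k e
  define l where "l e = (if e < r then lam e else lam' (e - r))" for e
  have g: "memL2 (M k) (g k e)" if "k < d" "e < r + s" for k e
    using dec that by (auto simp: is_decomp_def g_def)
  define A where "A = {..<r}"
  define B where "B = (\<lambda>p. p + r) ` {..<s}"
  have sumA: "(\<Sum>e\<in>A. l e * tensor d (\<lambda>k. g k e) x) = (\<Sum>p<r. lam p * tensor d (\<lambda>k. \<phi> k p) x)" for x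
    unfolding A_def by (rule sum.cong) (auto simp: l_def g_def)
  have sumB: "(\<Sum>e\<in>B. l e * tensor d (\<lambda>k. g k e) x) = (\<Sum>p<s. lam' p * tensor d (\<lambda>k. \<psi> k p) x)" for x
    unfolding B_def by (subst sum.reindex) (auto simp: l_def g_def)
  have ae: "AE x in prodM d M. (\<Sum>e\<in>A. l e * tensor d (\<lambda>k. g k e) x) = (\<Sum>e\<in>B. l e * tensor d (\<lambda>k. g k e) x)"
  proof -
    have "AE x in prodM d M. f x = (\<Sum>p<r. lam p * tensor d (\<lambda>k. \<phi> k p) x)"
      "AE x in prodM d M. f x = (\<Sum>p<s. lam' p * tensor d (\<lambda>k. \<psi> k p) x)"
      using dec by (auto simp: is_decomp_def)
    then show ?thesis unfolding sumA sumB by eventually_elim simp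
  qed
  have lc: "lcomb (ptensor d (gram M (r+s) g)) A l = lcomb (ptensor d (gram M (r+s) g)) B l"
    by (rule lcomb_ptensor_gram[OF sigma g _ _ ae]) (auto simp: A_def B_def)
  have "frank (gram M (r+s) g k) S = card S" if k: "k < d" and S: "S \<subseteq> A" and c: "card S \<le> K k" for k S
  proof (rule frank_gram)
    have "lin_indep_L2 (M k) (\<phi> k) S" using indep k S c by (simp add: A_def)
    moreover have "(\<Sum>p\<in>S. c p * g k p x) = (\<Sum>p\<in>S. c p * \<phi> k p x)" for c x
      by (rule sum.cong) (use S in \<open>auto simp: A_def g_def\<close>)
    ultimately show "lin_indep_L2 (M k) (g k) S" by (simp add: lin_indep_L2_def)
  qed (use g k S in \<open>auto simp: A_def\<close>)
  then have "\<exists>h. bij_betw h A B \<and>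
    (\<forall>a\<in>A. \<forall>z. l a * ptensor d (gram M (r+s) g) a z = l (h a) * ptensor d (gram M (r+s) g) (h a) z)"
    by (intro kruskal_matching[where ?A0.0 = A, OF K sumK _ _ _ _ _ _ _ _ lc])
      (use s nonzero in \<open>auto simp: A_def B_def l_def card_image\<close>)
  then obtain h where h: "bij_betw h A B"
    "\<And>a z. a \<in> A \<Longrightarrow> l a * ptensor d (gram M (r+s) g) a z = l (h a) * ptensor d (gram M (r+s) g) (h a) z"
    by blast
  \<comment> \<open>\<open>h\<close> leads from the given terms to the shifted new ones, so
    \<open>\<pi>\<close> is its inverse after the shift.\<close>
  define \<pi> where "\<pi> = inv_into A h \<circ> (\<lambda>p. p + r)"
  have "bij_betw (\<lambda>p. p + r) {..<s} B" by (auto simp: bij_betw_def B_def)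
  then have bij: "bij_betw \<pi> {..<s} {..<r}"
    unfolding \<pi>_def A_def[symmetric] by (rule bij_betw_trans) (rule bij_betw_inv_into[OF h(1)])
  have "AE x in prodM d M. lam' p * tensor d (\<lambda>k. \<psi> k p) x = lam (\<pi> p) * tensor d (\<lambda>k. \<phi> k (\<pi> p)) x"
    if p: "p < s" for p
  proof -
    have \<pi>p: "\<pi> p < r" using bij p by (auto simp: bij_betw_def)
    have hp: "h (\<pi> p) = p + r"
      using bij_betw_inv_into_right[OF h(1), of "p + r"] p by (simp add: \<pi>_def B_def)
    have "AE x in prodM d M. l (\<pi> p) * tensor d (\<lambda>k. g k (\<pi> p)) x = l (p + r) * tensor d (\<lambda>k. g k (p + r)) x"
      by (rule AE_eq_if_ptensor_gram_eq[where n = "r + s", OF sigma g]) (use h(2)[of "\<pi> p"] hp \<pi>p p in \<open>auto simp: A_def\<close>)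
    then show ?thesis using \<pi>p by (simp add: l_def g_def eq_commute)
  qed
  then show ?thesis using bij by blast
qed

section \<open>Kruskal rank and coherence\<close>

lemma lin_indep_L2_subset:
  assumes "lin_indep_L2 M g T" "S \<subseteq> T" "finite T"
  shows "lin_indep_L2 M g S"
  unfolding lin_indep_L2_def
proof (intro allI impI ballI)
  fix c p assume c: "AE x in M. (\<Sum>p\<in>S. c p * g p x) = 0" and p: "p \<in> S"
  let ?c = "\<lambda>p. if p \<in> S then c p else 0"
  have "(\<Sum>p\<in>T. ?c p * g p x) = (\<Sum>p\<in>S. c p * g p x)" for x
    by (rule sum.mono_neutral_cong_right) (use assms in auto)
  then have "AE x in M. (\<Sum>p\<in>T. ?c p * g p x) = 0" using c by simp
  then have "\<forall>p\<in>T. ?c p = 0"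
    using spec[OF assms(1)[unfolded lin_indep_L2_def], of ?c] by blast
  then have "?c p = 0" using p assms(2) by blast
  then show "c p = 0" using p by simp
qed

text \<open>\<open>GREATEST\<close> is meaningful because 0 qualifies, by the empty set, and
  \<open>r\<close> bounds all candidates. The third part supplies the dependent set from which the
  coherence estimate starts.\<close>

lemma krank_properties:
  shows "krank M g r \<le> r"
    and "S \<subseteq> {..<r} \<Longrightarrow> card S \<le> krank M g r \<Longrightarrow> lin_indep_L2 M g S"
    and "krank M g r < r \<Longrightarrow> \<exists>S\<subseteq>{..<r}. card S = krank M g r + 1 \<and> \<not> lin_indep_L2 M g S"
proof -
  let ?P = "\<lambda>k. k \<le> r \<and> (\<forall>S \<subseteq> {..<r}. card S = k \<longrightarrow> lin_indep_L2 M g S)"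
  have "?P 0"
  proof (intro conjI allI impI)
    fix S :: "nat set" assume "S \<subseteq> {..<r}" "card S = 0"
    then have "S = {}" using finite_subset[of S "{..<r}"] by simp
    then show "lin_indep_L2 M g S" by (simp add: lin_indep_L2_def)
  qed simp
  then have K: "?P (krank M g r)"
    unfolding krank_def by (rule GreatestI_nat[of ?P _ r]) auto
  then show "krank M g r \<le> r" by blast
  show "lin_indep_L2 M g S" if S: "S \<subseteq> {..<r}" "card S \<le> krank M g r"
  proof -
    obtain T where "S \<subseteq> T" "T \<subseteq> {..<r}" "card T = krank M g r"
      using exists_subset_between[of S "krank M g r" "{..<r}"] S K by auto
    then show ?thesis using K lin_indep_L2_subset[of M g T S] finite_subset by blast
  qed
  show "\<exists>S\<subseteq>{..<r}. card S = krank M g r + 1 \<and> \<not> lin_indep_L2 M g S" if "krank M g r < r"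
  proof (rule ccontr)
    assume "\<not> ?thesis"
    then have "?P (krank M g r + 1)" using that by auto
    then have "krank M g r + 1 \<le> krank M g r"
      unfolding krank_def by (rule Greatest_le_nat[of ?P _ r]) auto
    then show False by simp
  qed
qed

text \<open>Makes \<open>krank < dim_span\<close> yield \<open>krank < r\<close>, so that subsets of
  size \<open>krank + 1\<close> exist and one of them is dependent.\<close>

lemma dim_span_le: "dim_span M g r \<le> r"
proof -
  let ?P = "\<lambda>k. \<exists>S\<subseteq>{..<r}. card S = k \<and> lin_indep_L2 M g S"
  have b: "k \<le> r" if "?P k" for k
  proof -
    from that obtain S where "S \<subseteq> {..<r}" "card S = k" by blast
    then show ?thesis using card_mono[of "{..<r}" S] by simp
  qed
  have "?P 0" by (intro exI[of _ "{}"]) (auto simp: lin_indep_L2_def)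
  then have "?P (dim_span M g r)" unfolding dim_span_def by (rule GreatestI_nat[of ?P _ r]) (rule b)
  then show ?thesis by (rule b)
qed

lemma inner_le_coherence:
  assumes "p < r" "q < r" "p \<noteq> q"
  shows "cmod (L2_inner M (g p) (g q)) \<le> coherence M g r"
  unfolding coherence_def
proof (rule Max_ge)
  have "{cmod (L2_inner M (g p) (g q)) |p q. p < r \<and> q < r \<and> p \<noteq> q}
    \<subseteq> (\<lambda>(p, q). cmod (L2_inner M (g p) (g q))) ` ({..<r} \<times> {..<r})" by auto
  then show "finite {cmod (L2_inner M (g p) (g q)) |p q. p < r \<and> q < r \<and> p \<noteq> q}"
    by (rule finite_subset) auto
qed (use assms in auto)

text \<open>A dependent set of size \<open>K + 1\<close> carries a relation; pairing it with the
  member of largest coefficient bounds that coefficient by \<open>K * \<mu>\<close> times itself.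
  Hence \<open>1 \<le> K * \<mu>\<close>, which is the claim on \<open>omega\<close> after division
  by \<open>\<mu>\<close>.\<close>

lemma omega_le_krank:
  assumes g: "\<And>p. p < r \<Longrightarrow> memL2 M (g p)" and unit: "\<And>p. p < r \<Longrightarrow> L2_norm M (g p) = 1"
    and less: "krank M g r < r"
  shows "1 \<le> krank M g r" and "omega M g r \<le> real (krank M g r) - 1"
proof -
  define \<mu> where "\<mu> = coherence M g r"
  define K where "K = krank M g r"
  obtain S where S: "S \<subseteq> {..<r}" "card S = K + 1" "\<not> lin_indep_L2 M g S"
    using krank_properties(3)[OF less] by (auto simp: K_def)
  have finS: "finite S" using S finite_subset by blast
  obtain c p0 where c: "AE x in M. (\<Sum>q\<in>S. c q * g q x) = 0" and p0: "p0 \<in> S" "c p0 \<noteq> 0"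
    using S(3) unfolding lin_indep_L2_def by blast
  have "Max ((\<lambda>q. cmod (c q)) ` S) \<in> (\<lambda>q. cmod (c q)) ` S"
    by (rule Max_in) (use finS p0 in auto)
  then obtain p where p: "p \<in> S" "cmod (c p) = Max ((\<lambda>q. cmod (c q)) ` S)" by auto
  have max: "cmod (c q) \<le> cmod (c p)" if "q \<in> S" for q
    using that finS by (auto simp: p(2))
  have pos: "cmod (c p) > 0" by (rule less_le_trans[OF _ max[OF p0(1)]]) (use p0(2) in simp)
  have "0 = L2_inner M (\<lambda>x. \<Sum>q\<in>S. c q * g q x) (g p)"
    unfolding L2_inner_def by (rule integral_eq_zero_AE[symmetric]) (use c in auto)
  also have "\<dots> = (\<Sum>q\<in>S. c q * L2_inner M (g q) (g p))"
    by (rule L2_inner_sum(2)) (use g S p in \<open>auto intro: integrable_L2_inner\<close>)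
  also have "\<dots> = c p + (\<Sum>q\<in>S - {p}. c q * L2_inner M (g q) (g p))"
    using p S unit[of p] finS by (subst sum.remove[of S p]) (auto simp: L2_inner_self)
  finally have "c p = - (\<Sum>q\<in>S - {p}. c q * L2_inner M (g q) (g p))"
    by (simp add: add_eq_0_iff2)
  then have "cmod (c p) = cmod (\<Sum>q\<in>S - {p}. c q * L2_inner M (g q) (g p))"
    by (simp only: norm_minus_cancel)
  also have "\<dots> \<le> (\<Sum>q\<in>S - {p}. cmod (c q * L2_inner M (g q) (g p)))"
    by (rule norm_sum)
  also have "\<dots> \<le> (\<Sum>q\<in>S - {p}. cmod (c p) * \<mu>)"
    unfolding norm_mult \<mu>_def using S(1) p(1) max
    by (intro sum_mono mult_mono inner_le_coherence) auto
  also have "\<dots> = cmod (c p) * (K * \<mu>)" using S(2) p finS by simp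
  finally have *: "1 \<le> K * \<mu>" using pos by simp
  show 1: "1 \<le> krank M g r" using * by (cases "K = 0") (auto simp: K_def)
  \<comment> \<open>Excludes the default value of division by zero in \<open>omega\<close>.\<close>
  have "\<mu> > 0"
  proof (rule ccontr)
    assume "\<not> \<mu> > 0"
    then have "K * \<mu> \<le> 0" by (intro mult_nonneg_nonpos) auto
    with * show False by simp
  qed
  then show "omega M g r \<le> real (krank M g r) - 1"
    using * unfolding omega_def \<mu>_def[symmetric] K_def[symmetric]
    by (simp only: pos_divide_le_eq left_diff_distrib)
qed

theorem theorem5:
  fixes d r :: nat
    and M :: "nat \<Rightarrow> 'a measure"
    and f :: "(nat \<Rightarrow> 'a) \<Rightarrow> complex"
    and lam :: "nat \<Rightarrow> complex"
    and \<phi> :: "nat \<Rightarrow> nat \<Rightarrow> 'a \<Rightarrow> complex"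
  assumes sigma: "\<And>k. k < d \<Longrightarrow> sigma_finite_measure (M k)"
    and fL2: "memL2 (prodM d M) f"
    and decomp: "is_decomp d M f r lam \<phi>"
    and nonzero: "\<And>p. p < r \<Longrightarrow> lam p \<noteq> 0"
    and unit: "\<And>k p. k < d \<Longrightarrow> p < r \<Longrightarrow> L2_norm (M k) (\<phi> k p) = 1"
    and kr: "\<And>k. k < d \<Longrightarrow> krank (M k) (\<phi> k) r < dim_span (M k) (\<phi> k) r"
    and cond: "(\<Sum>k<d. omega (M k) (\<phi> k) r) \<ge> 2 * real r - 1"
  shows "tensor_rank d M f = r \<and>
    (\<forall>lam' \<psi>. is_decomp d M f r lam' \<psi> \<and>
        (\<forall>k<d. \<forall>p<r. L2_norm (M k) (\<psi> k p) = 1) \<longrightarrow>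
      (\<exists>\<pi>. \<pi> permutes {..<r} \<and>
        (\<forall>p<r. AE x in prodM d M.
           lam' p * tensor d (\<lambda>k. \<psi> k p) x = lam (\<pi> p) * tensor d (\<lambda>k. \<phi> k (\<pi> p)) x)))"
proof -
  define K where "K k = krank (M k) (\<phi> k) r" for k
  have mem: "memL2 (M k) (\<phi> k p)" if "k < d" "p < r" for k p
    using decomp that by (auto simp: is_decomp_def)
  have Kr: "krank (M k) (\<phi> k) r < r" if "k < d" for k
    using kr[OF that] dim_span_le[of "M k" "\<phi> k" r] by simp
  have K: "1 \<le> K k \<and> K k \<le> r" "omega (M k) (\<phi> k) r \<le> real (K k) - 1" if "k < d" for k
    using omega_le_krank[OF mem[OF that] unit[OF that] Kr[OF that]] krank_properties(1)[of "M k" "\<phi> k" r]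
    unfolding K_def by blast+
  have "2 * real r - 1 \<le> (\<Sum>k<d. real (K k) - 1)"
    by (rule order.trans[OF cond sum_mono]) (use K(2) in auto)
  then have "real (2 * r + d) \<le> real ((\<Sum>k<d. K k) + 1)"
    by (simp add: sum_subtractf)
  then have sumK: "2 * r + d \<le> (\<Sum>k<d. K k) + 1" by (simp only: of_nat_le_iff)
  \<comment> \<open>Used twice: with \<open>s < r\<close> the bijection is impossible, which gives
    the rank; with \<open>s = r\<close> it is the relabelling.\<close>
  have unique: "\<exists>\<pi>. bij_betw \<pi> {..<s} {..<r} \<and> (\<forall>p<s. AE x in prodM d M.
      lam' p * tensor d (\<lambda>k. \<psi> k p) x = lam (\<pi> p) * tensor d (\<lambda>k. \<phi> k (\<pi> p)) x)"
    if "is_decomp d M f s lam' \<psi>" "s \<le> r" for s lam' \<psi>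
    by (rule kruskal_L2[OF sigma decomp that nonzero K(1) sumK]) (auto simp: K_def krank_properties(2))
  have "tensor_rank d M f = r"
    unfolding tensor_rank_def
  proof (rule Least_equality)
    show "\<exists>c \<psi>. is_decomp d M f r c \<psi>" using decomp by blast
    fix s assume "\<exists>c \<psi>. is_decomp d M f s c \<psi>"
    then obtain c \<psi> where dec: "is_decomp d M f s c \<psi>" by blast
    show "r \<le> s"
    proof (rule ccontr)
      assume "\<not> r \<le> s"
      then obtain \<pi> where "bij_betw \<pi> {..<s} {..<r}" using unique[OF dec] by auto
      then have "card {..<s} = card {..<r}" by (rule bij_betw_same_card)
      then show False using \<open>\<not> r \<le> s\<close> by simp
    qed
  qed
  moreover have "\<exists>\<pi>. \<pi> permutes {..<r} \<and> (\<forall>p<r. AE x in prodM d M.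
           lam' p * tensor d (\<lambda>k. \<psi> k p) x = lam (\<pi> p) * tensor d (\<lambda>k. \<phi> k (\<pi> p)) x)"
    if dec: "is_decomp d M f r lam' \<psi>" for lam' \<psi>
  proof -
    obtain \<pi> where \<pi>: "bij_betw \<pi> {..<r} {..<r}" "\<forall>p<r. AE x in prodM d M.
      lam' p * tensor d (\<lambda>k. \<psi> k p) x = lam (\<pi> p) * tensor d (\<lambda>k. \<phi> k (\<pi> p)) x"
      using unique[OF dec] by blast
    \<comment> \<open>\<open>permutes\<close> requires the identity outside
      \<open>{..<r}\<close>.\<close>
    let ?\<pi> = "\<lambda>p. if p < r then \<pi> p else p"
    have "bij_betw ?\<pi> {..<r} {..<r}" by (rule bij_betw_cong[THEN iffD1, OF _ \<pi>(1)]) simp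
    then have "?\<pi> permutes {..<r}" by (rule bij_imp_permutes) simp
    then show ?thesis using \<pi>(2) by (intro exI[of _ ?\<pi>]) simp
  qed
  ultimately show ?thesis by blast
qed

end
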